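(* Let $n\ge 2$ and $1\le m<n$ be integers. Let $A$ be any Young function satisfying $$\int_0\left(\frac{s}{A(s)}\right)^{\frac{m}{n-m}}\,ds<\infty$$ (convergence of the integral near $0$). Let $A_{\frac nm}$ be the Young function defined by $A_{\frac nm}(s)=A\bigl(H_{\frac nm}^{-1}(s)\bigr)$ for $s\ge 0$, where $H_{\frac nm}^{-1}$ is the generalized left-continuous inverse of $$H_{\frac nm}(r)=\left(\int_0^r\left(\frac{t}{A(t)}\right)^{\frac{m}{n-m}}\,dt\right)^{\frac{n-m}{n}},\qquad r\ge 0.$$ Let $\Omega$ be any open set in $\mathbb{R}^n$ and suppose that the continuous embedding $W^{m,A}(\Omega)\hookrightarrow L^{A_{\frac nm}}(\Omega)$ holds, i.e. there is a constant $C>0$ such that $\|u\|_{L^{A_{n/m}}(\Omega)}\le C\|u\|_{W^{m,A}(\Omega)}$ for all $u\in W^{m,A}(\Omega)$. If the local upper Boyd index of $A$ satisfies $I_A<\frac nm$, then $\Omega$ satisfies the measure density condition: there exists a constant $c>0$ such that for all $x\in\Omega$ and all $0<r\le 1$, $$|B(x,r)\cap\Omega|\ge c\,r^n.$$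
   Context: $|S|$ denotes the Lebesgue measure of $S\subset\mathbb{R}^n$, and $B(x,r)$ is the ball of center $x$ and radius $r$. Young function: a function $A:[0,\infty)\to[0,\infty]$ of the form $A(s)=\int_0^s a(r)\,dr$, where $a:[0,\infty)\to[0,\infty]$, $a(0)=0$, is increasing (non-decreasing), left-continuous, and neither identically zero nor identically infinite on $(0,\infty)$. Generalized left-continuous inverse of a non-decreasing function $F:[0,\infty)\to[0,\infty]$: $F^{-1}(r)=\inf\{s\ge 0: F(s)\ge r\}$. Local upper Boyd index: $I_A=\inf_{0<t<1}\frac{\log t}{\log h_A(t)}$, where $h_A(t)=\limsup_{s\to\infty}\frac{A^{-1}(st)}{A^{-1}(s)}$ for $t>0$, and here $A^{-1}(r)=\inf\{s\ge0: A(s)>r\}$ is the right-continuous inverse of $A$ (the quotient $\frac{\log t}{\log h_A(t)}$ is read as $+\infty$ if $h_A(t)=1$). Orlicz space: $L^A(\Omega)$ is the space of measurable $f$ on $\Omega$ with $\int_\Omega A(|f(x)|/\lambda)\,dx<\infty$ for some $\lambda>0$, with Luxemburg norm $\|f\|_{L^A(\Omega)}=\inf\{\lambda>0:\int_\Omega A(|f(x)|/\lambda)\,dx\le 1\}$. Orlicz–Sobolev space: $W^{m,A}(\Omega)$ is the space of $u\in L^A(\Omega)$ that are $m$-times weakly differentiable in $\Omega$ with $\nabla^\alpha u\in L^A(\Omega)$ for every multi-index $\alpha$ with $|\alpha|\le m$, with norm $\|u\|_{W^{m,A}(\Omega)}=\sum_{|\alpha|\le m}\|\nabla^\alpha u\|_{L^A(\Omega)}$;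 here $\nabla^\alpha u=\frac{\partial^{|\alpha|}u}{\partial x_1^{\alpha_1}\cdots\partial x_n^{\alpha_n}}$. *)

theory Defs
  imports "HOL-Analysis.Analysis"
begin

text \<open>
  Functions from $[0,\infty)$ to $[0,\infty]$ are rendered as functions of type
  \<^typ>\<open>real \<Rightarrow> ennreal\<close>; their values at negative arguments are never used.
\<close>

section \<open>Young functions\<close>

definition young_function :: "(real \<Rightarrow> ennreal) \<Rightarrow> bool" where
  "young_function A \<longleftrightarrow> (\<exists>a :: real \<Rightarrow> ennreal.
     a 0 = 0 \<and> mono_on {0..} a \<and> (\<forall>s>0. continuous (at_left s) a) \<and>
     (\<exists>r>0. a r \<noteq> 0) \<and> (\<exists>r>0. a r \<noteq> \<infinity>) \<and>
     (\<forall>s\<ge>0. A s = (\<integral>\<^sup>+ r\<in>{0..s}. a r \<partial>lborel)))"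

text \<open>The infimum of the empty set is $\infty$ in both inverses.\<close>

definition left_inverse :: "(real \<Rightarrow> ennreal) \<Rightarrow> real \<Rightarrow> ennreal" where
  "left_inverse F r = (INF s\<in>{s. 0 \<le> s \<and> ennreal r \<le> F s}. ennreal s)"

definition right_inverse :: "(real \<Rightarrow> ennreal) \<Rightarrow> real \<Rightarrow> ennreal" where
  "right_inverse F r = (INF s\<in>{s. 0 \<le> s \<and> ennreal r < F s}. ennreal s)"

definition boyd_h :: "(real \<Rightarrow> ennreal) \<Rightarrow> real \<Rightarrow> ennreal" where
  "boyd_h A t = Limsup at_top (\<lambda>s. right_inverse A (s * t) / right_inverse A s)"

text \<open>
  For a Young function and $0 < t < 1$ one has $t \le h_A(t) \le 1$ by convexity, so passing to
  the real logarithm of \<^term>\<open>enn2real (boyd_h A t)\<close> loses nothing.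
\<close>

definition upper_boyd_index :: "(real \<Rightarrow> ennreal) \<Rightarrow> ereal" where
  "upper_boyd_index A =
     (INF t\<in>{0<..<1}. if boyd_h A t = 1 then \<infinity> else ereal (ln t / ln (enn2real (boyd_h A t))))"

section \<open>The Sobolev conjugate\<close>

text \<open>Power with a positive real exponent, where $\infty^p = \infty$.\<close>

definition ennreal_powr :: "ennreal \<Rightarrow> real \<Rightarrow> ennreal" where
  "ennreal_powr x p = (if x = \<infinity> then \<infinity> else ennreal (enn2real x powr p))"

text \<open>
  In \<^typ>\<open>ennreal\<close>, $s/0 = \infty$ for $s > 0$ and $s/\infty = 0$, so the integrand is infinite
  where $A$ vanishes and zero where $A$ is infinite.
\<close>

definition sobolev_integrand :: "nat \<Rightarrow> nat \<Rightarrow> (real \<Rightarrow> ennreal) \<Rightarrow> real \<Rightarrow> ennreal" where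
  "sobolev_integrand n m A s = ennreal_powr (ennreal s / A s) (real m / (real n - real m))"

definition sobolev_H :: "nat \<Rightarrow> nat \<Rightarrow> (real \<Rightarrow> ennreal) \<Rightarrow> real \<Rightarrow> ennreal" where
  "sobolev_H n m A r =
     ennreal_powr (\<integral>\<^sup>+ t\<in>{0..r}. sobolev_integrand n m A t \<partial>lborel) ((real n - real m) / real n)"

text \<open>
  If $H_{n/m}$ is bounded, its inverse takes the value $\infty$ at arguments above the supremum;
  there $A_{n/m}$ is $A(\infty) = \lim_{s\to\infty} A(s) = \infty$.
\<close>

definition sobolev_conjugate :: "nat \<Rightarrow> nat \<Rightarrow> (real \<Rightarrow> ennreal) \<Rightarrow> real \<Rightarrow> ennreal" where
  "sobolev_conjugate n m A s =
     (let y = left_inverse (sobolev_H n m A) s in if y = \<infinity> then \<infinity> else A (enn2real y))"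

section \<open>Orlicz spaces\<close>

definition orlicz_space :: "(real \<Rightarrow> ennreal) \<Rightarrow> (real^'n) set \<Rightarrow> (real^'n \<Rightarrow> real) set" where
  "orlicz_space A \<Omega> = {f \<in> borel_measurable (lebesgue_on \<Omega>).
     \<exists>k>0. (\<integral>\<^sup>+ x. A (\<bar>f x\<bar> / k) \<partial>lebesgue_on \<Omega>) < \<infinity>}"

text \<open>The Luxemburg norm of a measurable function is $\infty$ outside the Orlicz space.\<close>

definition orlicz_norm :: "(real \<Rightarrow> ennreal) \<Rightarrow> (real^'n) set \<Rightarrow> (real^'n \<Rightarrow> real) \<Rightarrow> ennreal" where
  "orlicz_norm A \<Omega> f =
     (INF k\<in>{k. 0 < k \<and> (\<integral>\<^sup>+ x. A (\<bar>f x\<bar> / k) \<partial>lebesgue_on \<Omega>) \<le> 1}. ennreal k)"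

section \<open>Weak derivatives\<close>

definition partial_deriv :: "'n::finite \<Rightarrow> (real^'n \<Rightarrow> real) \<Rightarrow> real^'n \<Rightarrow> real" where
  "partial_deriv i f = (\<lambda>x. frechet_derivative f (at x) (axis i 1))"

definition smooth_fun :: "(real^'n \<Rightarrow> real) \<Rightarrow> bool" where
  "smooth_fun f \<longleftrightarrow> (\<forall>is x. foldr partial_deriv is f differentiable (at x))"

definition test_functions :: "(real^'n) set \<Rightarrow> (real^'n \<Rightarrow> real) set" where
  "test_functions \<Omega> = {\<phi>. smooth_fun \<phi> \<and>
     compact (closure {x. \<phi> x \<noteq> 0}) \<and> closure {x. \<phi> x \<noteq> 0} \<subseteq> \<Omega>}"

text \<open>
  Multi-indices are functions on the finite index type. The coordinates are differentiated in a
  fixed but arbitrary order; for the smooth functions to which this is applied the order is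
  immaterial.
\<close>

definition coordinates :: "'n::finite list" where
  "coordinates = (SOME is. distinct is \<and> set is = UNIV)"

definition multi_deriv :: "('n::finite \<Rightarrow> nat) \<Rightarrow> (real^'n \<Rightarrow> real) \<Rightarrow> real^'n \<Rightarrow> real" where
  "multi_deriv \<alpha> f = foldr (\<lambda>i g. (partial_deriv i ^^ \<alpha> i) g) coordinates f"

definition multi_order :: "('n::finite \<Rightarrow> nat) \<Rightarrow> nat" where
  "multi_order \<alpha> = (\<Sum>i\<in>UNIV. \<alpha> i)"

definition locally_integrable :: "(real^'n) set \<Rightarrow> (real^'n \<Rightarrow> real) \<Rightarrow> bool" where
  "locally_integrable \<Omega> f \<longleftrightarrow> (\<forall>K. compact K \<and> K \<subseteq> \<Omega> \<longrightarrow> integrable (lebesgue_on K) f)"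

definition has_weak_deriv ::
  "(real^'n) set \<Rightarrow> ('n \<Rightarrow> nat) \<Rightarrow> (real^'n \<Rightarrow> real) \<Rightarrow> (real^'n \<Rightarrow> real) \<Rightarrow> bool" where
  "has_weak_deriv \<Omega> \<alpha> u v \<longleftrightarrow> locally_integrable \<Omega> u \<and> locally_integrable \<Omega> v \<and>
     (\<forall>\<phi>\<in>test_functions \<Omega>.
        (\<integral>x. u x * multi_deriv \<alpha> \<phi> x \<partial>lebesgue_on \<Omega>) =
        (-1) ^ multi_order \<alpha> * (\<integral>x. v x * \<phi> x \<partial>lebesgue_on \<Omega>))"

text \<open>
  Weak derivatives are unique up to null sets, on which Orlicz norms do not depend.
\<close>

definition weak_deriv ::
  "(real^'n) set \<Rightarrow> ('n \<Rightarrow> nat) \<Rightarrow> (real^'n \<Rightarrow> real) \<Rightarrow> real^'n \<Rightarrow> real" where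
  "weak_deriv \<Omega> \<alpha> u = (SOME v. has_weak_deriv \<Omega> \<alpha> u v)"

section \<open>Orlicz--Sobolev spaces\<close>

definition orlicz_sobolev_space ::
  "nat \<Rightarrow> (real \<Rightarrow> ennreal) \<Rightarrow> (real^'n) set \<Rightarrow> (real^'n \<Rightarrow> real) set" where
  "orlicz_sobolev_space m A \<Omega> = {u \<in> orlicz_space A \<Omega>. \<forall>\<alpha>. multi_order \<alpha> \<le> m \<longrightarrow>
     (\<exists>v. has_weak_deriv \<Omega> \<alpha> u v) \<and> weak_deriv \<Omega> \<alpha> u \<in> orlicz_space A \<Omega>}"

definition orlicz_sobolev_norm ::
  "nat \<Rightarrow> (real \<Rightarrow> ennreal) \<Rightarrow> (real^'n) set \<Rightarrow> (real^'n \<Rightarrow> real) \<Rightarrow> ennreal" where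
  "orlicz_sobolev_norm m A \<Omega> u =
     (\<Sum>\<alpha> | multi_order \<alpha> \<le> m. orlicz_norm A \<Omega> (weak_deriv \<Omega> \<alpha> u))"

text \<open>The index set of the sum is finite.\<close>

lemma finite_multi_order_le: "finite {\<alpha> :: 'n::finite \<Rightarrow> nat. multi_order \<alpha> \<le> m}"
proof (rule finite_subset)
  show "{\<alpha> :: 'n \<Rightarrow> nat. multi_order \<alpha> \<le> m} \<subseteq> Pi\<^sub>E UNIV (\<lambda>_. {..m})"
  proof
    fix \<alpha> :: "'n \<Rightarrow> nat"
    assume "\<alpha> \<in> {\<alpha>. multi_order \<alpha> \<le> m}"
    moreover have "\<alpha> i \<le> multi_order \<alpha>" for i
      unfolding multi_order_def by (rule member_le_sum) auto
    ultimately show "\<alpha> \<in> Pi\<^sub>E UNIV (\<lambda>_. {..m})"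
      by (auto intro: order_trans)
  qed
qed (auto intro: finite_PiE)

end

theory Submission
  imports Defs
begin

text \<open>
  The embedding is tested on bumps at all scales. Fix \<open>x \<in> \<Omega>\<close>, write
  \<open>f(\<rho>) = |B(x,\<rho>) \<inter> \<Omega>|\<close>, and let \<open>u\<close> be a smooth bump supported in \<open>B(x,R)\<close> and bounded below
  on \<open>B(x,R/2)\<close>, where \<open>R \<le> 1\<close>. Its derivatives of order at most \<open>m\<close> are \<open>O(R\<^sup>-\<^sup>m)\<close>, so the
  Sobolev norm is at most a constant times \<open>R\<^sup>-\<^sup>m / s\<close> whenever \<open>A(s) \<le> 1 / f(R)\<close>
  (\<open>rescaled_bump_sobolev\<close>), while the norm in the target space is at least a constant over \<open>H(s')\<close>
  whenever \<open>A(s') > 1 / f(R/2)\<close> (\<open>orlicz_norm_conjugate_ge\<close>). The embedding therefore gives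
  \<open>R\<^sup>m \<le> const \<sqdot> H(s') / s\<close>.

  The Boyd index bound says that \<open>A\<close> grows at infinity more slowly than the power \<open>n/m\<close>, in the
  scale invariant sense that \<open>A(\<sigma>a) \<ge> t A(a)\<close> for all large \<open>a\<close>, with fixed \<open>\<sigma>, t < 1\<close> and
  \<open>\<sigma> powr (n/m) < t\<close> (\<open>boyd_index_growth\<close>). The integral defining \<open>H(r)\<close> is then governed by its upper
  end, whence \<open>H(r) \<le> K r A(r) powr (-m/n)\<close> for large \<open>r\<close> (\<open>sobolev_H_upper_bound\<close>). If \<open>f(R)\<close> is small
  and comparable with \<open>f(R/2)\<close>, then \<open>s\<close> and \<open>s'\<close> may be taken comparable, with \<open>A(s)\<close> and \<open>A(s')\<close>
  comparable to \<open>1 / f(R)\<close> (\<open>young_conjugate_gap\<close>), and the inequality above becomes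
  \<open>R\<^sup>n \<le> const \<sqdot> f(R)\<close>.

  Such a radius \<open>R\<close> is found as an almost minimiser of \<open>f(\<rho>) / \<rho>\<^sup>n\<close> over \<open>0 < \<rho> \<le> 1\<close>
  (\<open>doubling_radius\<close>). The infimum is positive because \<open>x\<close> is an interior point of \<open>\<Omega>\<close>; near the
  infimum \<open>f(R/2) \<ge> 2\<^sup>-\<^sup>n\<^sup>-\<^sup>1 f(R)\<close>, and a lower bound for \<open>f(R) / R\<^sup>n\<close> carries over, up to a
  factor 2, to every other radius. If \<open>f(R)\<close> is not small, such a bound is immediate from \<open>R \<le> 1\<close>.
  This replaces an iteration over shrinking balls, and the constant depends on neither \<open>x\<close> nor the
  size of the infimum.

  Since weak derivatives are picked by a choice operator, estimating the Sobolev norm of a bump also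
  requires that a weak derivative is determined almost everywhere (\<open>has_weak_deriv_unique\<close>).
\<close>

section \<open>Smooth functions\<close>

text \<open>
  The classical flat functions \<open>exp (-1/t) / t\<^sup>k\<close>, extended by zero. The negative powers are included
  so that the derivative of a member of the family is a combination of members.
\<close>
definition flat :: "nat \<Rightarrow> real \<Rightarrow> real" where
  "flat k t = (if t \<le> 0 then 0 else exp (- (1 / t)) / t ^ k)"

lemma flat_nonneg: "0 \<le> flat k t"
  by (simp add: flat_def)

lemma flat_0_le_1: "flat 0 t \<le> 1"
  by (simp add: flat_def)

lemma flat_0_mono: "s \<le> t \<Longrightarrow> flat 0 s \<le> flat 0 t"
  by (auto simp: flat_def intro!: divide_left_mono)

text \<open>The exponential beats every power; the substitution \<open>1/t\<close> turns this into a limit at infinity.\<close>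
lemma flat_tendsto_0_at_right: "(flat k \<longlongrightarrow> 0) (at_right 0)"
proof -
  have "((\<lambda>t::real. (inverse t) ^ k / exp (inverse t)) \<longlongrightarrow> 0) (at_right 0)"
    by (rule filterlim_compose[OF tendsto_power_div_exp_0 filterlim_inverse_at_top_right])
  moreover have "eventually (\<lambda>t::real. (inverse t) ^ k / exp (inverse t) = flat k t) (at_right 0)"
    by (auto simp: eventually_at_right_less flat_def exp_minus field_simps
        intro!: eventually_mono[OF eventually_at_right_less[of 0]])
  ultimately show ?thesis
    by (rule Lim_transform_eventually)
qed

lemma flat_tendsto_0: "(flat k \<longlongrightarrow> 0) (at 0)"
proof -
  have "(flat k \<longlongrightarrow> 0) (at_left 0)"
    by (rule tendsto_eventually) (auto simp: flat_def eventually_at_left_field intro!: exI[of _ "-1"])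
  with flat_tendsto_0_at_right show ?thesis
    by (simp add: filterlim_at_split)
qed

text \<open>At the origin the difference quotient of \<open>flat k\<close> is \<open>flat (k + 1)\<close>, which tends to zero.\<close>
lemma has_real_derivative_flat:
  "(flat k has_real_derivative flat (Suc (Suc k)) t - real k * flat (Suc k) t) (at t)"
proof -
  consider "t < 0" | "t = 0" | "0 < t" by linarith
  then show ?thesis
  proof cases
    case 1
    have "((\<lambda>_. 0) has_real_derivative 0) (at t)" by simp
    then have "(flat k has_real_derivative 0) (at t)"
      by (rule has_field_derivative_transform_within_open[of _ _ _ "{..<0}"])
         (use 1 in \<open>auto simp: flat_def\<close>)
    with 1 show ?thesis by (simp add: flat_def)
  next
    case 2
    have "((\<lambda>h. (flat k (0 + h) - flat k 0) / h) \<longlongrightarrow> 0) (at 0)"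
      by (rule Lim_transform_eventually[OF flat_tendsto_0[of "Suc k"]])
         (auto simp: flat_def eventually_at intro!: exI[of _ 1])
    then have "(flat k has_real_derivative 0) (at 0)"
      by (simp add: DERIV_def)
    with 2 show ?thesis by (simp add: flat_def)
  next
    case 3
    have "((\<lambda>t. exp (- (1 / t)) / t ^ k) has_real_derivative
        flat (Suc (Suc k)) t - real k * flat (Suc k) t) (at t)"
    proof (cases k)
      case (Suc j)
      have "t ^ j = t * t ^ (j - Suc 0) \<or> j = 0" by (cases j) auto
      with 3 Suc show ?thesis
        by (auto intro!: derivative_eq_intros simp: flat_def field_simps power2_eq_square)
    qed (use 3 in \<open>auto intro!: derivative_eq_intros simp: flat_def field_simps power2_eq_square\<close>)
    then show ?thesis
      by (rule has_field_derivative_transform_within_open[of _ _ _ "{0<..}"])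
         (use 3 in \<open>auto simp: flat_def\<close>)
  qed
qed

text \<open>
  A syntactic class of functions closed under partial derivatives and rich enough to contain bumps
  supported in balls and in boxes. Smoothness of its members needs no induction over orders of
  differentiation: closure under one derivative suffices.
\<close>
inductive_set smooth_terms :: "(real^'n \<Rightarrow> real) set" where
  const: "(\<lambda>_. c) \<in> smooth_terms"
| coord: "(\<lambda>x. x $ i) \<in> smooth_terms"
| add: "f \<in> smooth_terms \<Longrightarrow> g \<in> smooth_terms \<Longrightarrow> (\<lambda>x. f x + g x) \<in> smooth_terms"
| mult: "f \<in> smooth_terms \<Longrightarrow> g \<in> smooth_terms \<Longrightarrow> (\<lambda>x. f x * g x) \<in> smooth_terms"
| flat: "f \<in> smooth_terms \<Longrightarrow> (\<lambda>x. flat k (f x)) \<in> smooth_terms"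

lemma smooth_terms_minus:
  assumes "f \<in> smooth_terms" "g \<in> smooth_terms"
  shows "(\<lambda>x. f x - g x) \<in> smooth_terms"
  using smooth_terms.add[OF assms(1) smooth_terms.mult[OF smooth_terms.const[of "-1"] assms(2)]]
  by simp

lemma smooth_terms_sum:
  "finite I \<Longrightarrow> (\<And>i. i \<in> I \<Longrightarrow> f i \<in> smooth_terms) \<Longrightarrow> (\<lambda>x. \<Sum>i\<in>I. f i x) \<in> smooth_terms"
  by (induction I rule: finite_induct) (auto intro: smooth_terms.intros)

lemma smooth_terms_prod:
  "finite I \<Longrightarrow> (\<And>i. i \<in> I \<Longrightarrow> f i \<in> smooth_terms) \<Longrightarrow> (\<lambda>x. \<Prod>i\<in>I. f i x) \<in> smooth_terms"
  by (induction I rule: finite_induct) (auto intro: smooth_terms.intros)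

text \<open>The sum, product and chain rules express the gradient by means of the constructors of the class.\<close>
lemma smooth_terms_has_gradient:
  fixes f :: "real^'n \<Rightarrow> real"
  assumes "f \<in> smooth_terms"
  shows "\<exists>g. (\<forall>i. g i \<in> smooth_terms) \<and>
    (\<forall>x. (f has_derivative (\<lambda>h. \<Sum>i\<in>UNIV. h $ i * g i x)) (at x))"
  using assms
proof induction
  case (const c)
  show ?case by (rule exI[of _ "\<lambda>_ _. 0"]) (auto intro: smooth_terms.intros)
next
  case (coord j)
  have "(\<lambda>h::real^'n. \<Sum>i\<in>UNIV. h $ i * (if i = j then 1 else 0)) = (\<lambda>h. h $ j)"
    by (simp add: if_distrib cong: if_cong)
  then show ?case
    by (intro exI[of _ "\<lambda>i _. if i = j then 1 else 0"])
       (auto intro: smooth_terms.intros bounded_linear_imp_has_derivative bounded_linear_vec_nth)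
next
  case (add f g)
  then obtain f' g' where *: "\<forall>i. f' i \<in> smooth_terms" "\<forall>i. g' i \<in> smooth_terms"
    "\<forall>x. (f has_derivative (\<lambda>h. \<Sum>i\<in>UNIV. h $ i * f' i x)) (at x)"
    "\<forall>x. (g has_derivative (\<lambda>h. \<Sum>i\<in>UNIV. h $ i * g' i x)) (at x)" by blast
  then show ?case
    by (intro exI[of _ "\<lambda>i x. f' i x + g' i x"])
       (auto intro: smooth_terms.intros intro!: has_derivative_eq_rhs[OF has_derivative_add]
         simp: fun_eq_iff distrib_left sum.distrib)
next
  case (mult f g)
  then obtain f' g' where *: "\<forall>i. f' i \<in> smooth_terms" "\<forall>i. g' i \<in> smooth_terms"
    "\<forall>x. (f has_derivative (\<lambda>h. \<Sum>i\<in>UNIV. h $ i * f' i x)) (at x)"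
    "\<forall>x. (g has_derivative (\<lambda>h. \<Sum>i\<in>UNIV. h $ i * g' i x)) (at x)" by blast
  show ?case
  proof (intro exI[of _ "\<lambda>i x. f x * g' i x + f' i x * g x"] conjI allI)
    show "(\<lambda>x. f x * g' i x + f' i x * g x) \<in> smooth_terms" for i
      using *(1,2) mult.hyps by (intro smooth_terms.add[OF smooth_terms.mult smooth_terms.mult]) auto
    show "((\<lambda>x. f x * g x) has_derivative
        (\<lambda>h. \<Sum>i\<in>UNIV. h $ i * (f x * g' i x + f' i x * g x))) (at x)" for x
      by (rule has_derivative_eq_rhs[OF has_derivative_mult[OF *(3)[rule_format] *(4)[rule_format]]])
         (simp add: fun_eq_iff sum_distrib_left sum_distrib_right sum.distrib[symmetric] algebra_simps)
  qed
next
  case (flat f k)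
  then obtain f' where *: "f \<in> smooth_terms" "\<forall>i. f' i \<in> smooth_terms"
    "\<forall>x. (f has_derivative (\<lambda>h. \<Sum>i\<in>UNIV. h $ i * f' i x)) (at x)" by blast
  define d where "d = (\<lambda>t. flat (Suc (Suc k)) t - real k * flat (Suc k) t)"
  have d': "(flat k has_real_derivative d t) (at t)" for t
    unfolding d_def by (rule has_real_derivative_flat)
  have d: "(\<lambda>x. d (f x)) \<in> smooth_terms"
    unfolding d_def using *(1) by (intro smooth_terms_minus smooth_terms.intros)
  show ?case
  proof (intro exI[of _ "\<lambda>i x. d (f x) * f' i x"] conjI allI)
    show "(\<lambda>x. d (f x) * f' i x) \<in> smooth_terms" for i
      using * d by (auto intro: smooth_terms.intros)
    show "((\<lambda>x. flat k (f x)) has_derivative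
        (\<lambda>h. \<Sum>i\<in>UNIV. h $ i * (d (f x) * f' i x))) (at x)" for x
      by (rule has_derivative_eq_rhs[OF has_derivative_compose[OF *(3)[rule_format]
            d'[THEN has_field_derivative_imp_has_derivative]]])
         (simp add: fun_eq_iff sum_distrib_left mult_ac)
  qed
qed

lemma partial_deriv_eq:
  assumes "(f has_derivative (\<lambda>h. \<Sum>i\<in>UNIV. h $ i * g i)) (at x)"
  shows "partial_deriv j f x = g j"
proof -
  have "frechet_derivative f (at x) = (\<lambda>h. \<Sum>i\<in>UNIV. h $ i * g i)"
    using frechet_derivative_at[OF assms] by simp
  moreover have "(\<Sum>i\<in>UNIV. axis j 1 $ i * g i) = (\<Sum>i\<in>UNIV. if i = j then g i else 0)"
    by (intro sum.cong) (auto simp: axis_def)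
  ultimately show ?thesis
    by (simp add: partial_deriv_def)
qed

lemma smooth_terms_partial_deriv:
  assumes "f \<in> smooth_terms"
  shows "partial_deriv i f \<in> smooth_terms"
proof -
  obtain g where g: "\<forall>i. g i \<in> smooth_terms"
    "\<forall>x. (f has_derivative (\<lambda>h. \<Sum>i\<in>UNIV. h $ i * g i x)) (at x)"
    using smooth_terms_has_gradient[OF assms] by blast
  then have "partial_deriv i f = g i"
    by (intro ext partial_deriv_eq) auto
  with g show ?thesis by simp
qed

lemma smooth_terms_differentiable:
  assumes "f \<in> smooth_terms"
  shows "f differentiable (at x)"
  using smooth_terms_has_gradient[OF assms] by (auto simp: differentiable_def)

lemma smooth_fun_smooth_terms:
  assumes "f \<in> smooth_terms"
  shows "smooth_fun f"
proof -
  have "foldr partial_deriv is f \<in> smooth_terms" for "is"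
    by (induction "is") (auto intro: smooth_terms_partial_deriv assms)
  then show ?thesis
    unfolding smooth_fun_def by (auto intro: smooth_terms_differentiable)
qed

lemma smooth_fun_foldr: "smooth_fun f \<Longrightarrow> smooth_fun (foldr partial_deriv is f)"
  unfolding smooth_fun_def by (metis foldr_append comp_apply)

lemma smooth_fun_partial_deriv: "smooth_fun f \<Longrightarrow> smooth_fun (partial_deriv i f)"
  using smooth_fun_foldr[of f "[i]"] by simp

lemma smooth_fun_differentiable: "smooth_fun f \<Longrightarrow> f differentiable (at x)"
  unfolding smooth_fun_def by (metis foldr_Nil id_apply)

lemma smooth_fun_continuous_on: "smooth_fun f \<Longrightarrow> continuous_on S f"
  by (meson smooth_fun_differentiable continuous_at_imp_continuous_on differentiable_imp_continuous_within)

lemma smooth_fun_borel_measurable: "smooth_fun f \<Longrightarrow> f \<in> borel_measurable borel"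
  by (intro borel_measurable_continuous_onI smooth_fun_continuous_on)

lemma partial_deriv_outside:
  assumes "closed K" "\<And>x. x \<notin> K \<Longrightarrow> f x = 0" "x \<notin> K"
  shows "partial_deriv i f x = 0"
proof -
  have "((\<lambda>_. 0) has_derivative (\<lambda>_. 0)) (at x)" by simp
  then have "(f has_derivative (\<lambda>_. 0)) (at x)"
    by (rule has_derivative_transform_within_open[of _ _ _ _ "- K"]) (use assms in auto)
  then have "frechet_derivative f (at x) = (\<lambda>_. 0)"
    using frechet_derivative_at by metis
  then show ?thesis by (simp add: partial_deriv_def)
qed

lemma foldr_partial_deriv_outside:
  assumes "closed K" "\<And>x. x \<notin> K \<Longrightarrow> f x = 0" "x \<notin> K"
  shows "foldr partial_deriv is f x = 0"
  using assms(3)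
  by (induction "is" arbitrary: x) (auto intro: partial_deriv_outside assms)

lemma differentiable_rescale:
  fixes f :: "'a::real_normed_vector \<Rightarrow> real"
  assumes "f differentiable (at (c *\<^sub>R (y - x)))"
  shows "(\<lambda>y. f (c *\<^sub>R (y - x))) differentiable (at y)"
proof -
  have "(\<lambda>y. c *\<^sub>R (y - x)) differentiable (at y)"
    by (intro derivative_intros)
  moreover have "f differentiable (at (c *\<^sub>R (y - x)) within range (\<lambda>y. c *\<^sub>R (y - x)))"
    using assms by (rule differentiable_at_withinI)
  ultimately show ?thesis
    using differentiable_chain_within[of "\<lambda>y. c *\<^sub>R (y - x)" y UNIV f] by (simp add: o_def)
qed

lemma partial_deriv_rescale:
  assumes "f differentiable (at (c *\<^sub>R (y - x)))"
  shows "partial_deriv i (\<lambda>y. f (c *\<^sub>R (y - x))) y = c * partial_deriv i f (c *\<^sub>R (y - x))"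
proof -
  let ?D = "frechet_derivative f (at (c *\<^sub>R (y - x)))"
  have D: "(f has_derivative ?D) (at (c *\<^sub>R (y - x)))"
    using assms frechet_derivative_works by blast
  have "((\<lambda>y. c *\<^sub>R (y - x)) has_derivative (\<lambda>h. c *\<^sub>R h)) (at y)"
    by (auto intro!: derivative_eq_intros)
  from has_derivative_compose[OF this D]
  have "frechet_derivative (\<lambda>y. f (c *\<^sub>R (y - x))) (at y) = (\<lambda>h. ?D (c *\<^sub>R h))"
    using frechet_derivative_at by metis
  then show ?thesis
    using linear_scale[OF has_derivative_linear[OF D]] by (simp add: partial_deriv_def)
qed

lemma partial_deriv_cmult:
  assumes "f differentiable (at x)"
  shows "partial_deriv i (\<lambda>y. c * f y) x = c * partial_deriv i f x"
proof -
  have "(f has_derivative frechet_derivative f (at x)) (at x)"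
    using assms frechet_derivative_works by blast
  then have "((\<lambda>y. c * f y) has_derivative (\<lambda>h. c * frechet_derivative f (at x) h)) (at x)"
    by (rule has_derivative_mult_right)
  then have "frechet_derivative (\<lambda>y. c * f y) (at x) = (\<lambda>h. c * frechet_derivative f (at x) h)"
    using frechet_derivative_at by metis
  then show ?thesis by (simp add: partial_deriv_def)
qed

text \<open>
  Every derivative produces one factor \<open>c\<close>. With \<open>c = 1/R\<close> this is what makes bounds for one bump
  uniform over centres and radii.
\<close>
lemma foldr_partial_deriv_rescale:
  assumes "smooth_fun f"
  shows "foldr partial_deriv is (\<lambda>y. f (c *\<^sub>R (y - x))) =
    (\<lambda>y. c ^ length is * foldr partial_deriv is f (c *\<^sub>R (y - x)))"
proof (induction "is")
  case (Cons i "is")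
  let ?g = "foldr partial_deriv is f"
  have g: "?g differentiable (at z)" for z
    using assms by (simp add: smooth_fun_def)
  have "(\<lambda>y. ?g (c *\<^sub>R (y - x))) differentiable (at y)" for y
    by (rule differentiable_rescale[OF g])
  then show ?case
    unfolding foldr.simps comp_apply Cons
    by (auto simp: fun_eq_iff partial_deriv_cmult partial_deriv_rescale g)
qed simp

lemma smooth_fun_rescale:
  assumes "smooth_fun f"
  shows "smooth_fun (\<lambda>y. f (c *\<^sub>R (y - x)))"
  unfolding smooth_fun_def foldr_partial_deriv_rescale[OF assms]
proof (intro allI)
  fix "is" y
  let ?g = "foldr partial_deriv is f"
  have "(\<lambda>y. ?g (c *\<^sub>R (y - x))) differentiable (at y)"
    by (rule differentiable_rescale) (use assms in \<open>simp add: smooth_fun_def\<close>)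
  then show "(\<lambda>y. c ^ length is * ?g (c *\<^sub>R (y - x))) differentiable (at y)"
    by (intro derivative_intros)
qed

text \<open>
  The radius \<open>sqrt (1/2)\<close> of the support is less than 1, so that all derivatives vanish outside the
  open unit ball, its boundary sphere included.
\<close>
definition bump :: "real^'n \<Rightarrow> real" where
  "bump x = flat 0 (1 / 2 - (\<Sum>i\<in>UNIV. x $ i * x $ i))"

lemma bump_eq: "bump x = flat 0 (1 / 2 - (norm x)\<^sup>2)"
  by (simp add: bump_def norm_vec_def L2_set_def power2_eq_square sum_nonneg)

lemma smooth_bump: "smooth_fun bump"
  unfolding bump_def
  by (intro smooth_fun_smooth_terms smooth_terms.intros smooth_terms_minus smooth_terms_sum) auto

lemma bump_nonneg: "0 \<le> bump x"
  by (simp add: bump_def flat_nonneg)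

lemma bump_ge:
  assumes "norm x \<le> 1 / 2"
  shows "exp (-4) \<le> bump x"
proof -
  have "(norm x)\<^sup>2 \<le> (1 / 2)\<^sup>2"
    using assms by (intro power_mono) auto
  then have "flat 0 (1 / 4) \<le> bump x"
    unfolding bump_eq by (intro flat_0_mono) (simp add: power2_eq_square)
  then show ?thesis by (simp add: flat_def)
qed

lemma foldr_partial_deriv_bump_outside:
  assumes "1 \<le> norm x"
  shows "foldr partial_deriv is bump x = 0"
proof (rule foldr_partial_deriv_outside)
  show "closed (cball 0 (sqrt (1 / 2)) :: (real^'n) set)" by simp
  show "bump y = 0" if "y \<notin> cball 0 (sqrt (1 / 2))" for y :: "real^'n"
  proof -
    have "sqrt (1 / 2) < norm y" using that by simp
    then have "1 / 2 < (norm y)\<^sup>2"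
      by (metis not_less real_le_rsqrt)
    then show ?thesis by (simp add: bump_eq flat_def)
  qed
  have "sqrt (1 / 2) < (1::real)" by (simp add: real_sqrt_lt_1_iff)
  then have "sqrt (1 / 2) < norm x" using assms by linarith
  then show "x \<notin> cball 0 (sqrt (1 / 2))" by (simp only: mem_cball_0 not_le)
qed

text \<open>
  Each derivative is continuous with compact support, and there are finitely many words of length at
  most \<open>m\<close> over the finite set of coordinates.
\<close>
lemma foldr_partial_deriv_bump_bounded:
  "\<exists>M>0. \<forall>is (x::real^'n). length is \<le> m \<longrightarrow> \<bar>foldr partial_deriv is bump x\<bar> \<le> M"
proof -
  have bdd: "\<exists>M. \<forall>x::real^'n. \<bar>foldr partial_deriv is bump x\<bar> \<le> M" for "is"
  proof -
    have "compact (foldr partial_deriv is bump ` cball (0::real^'n) 1)"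
      by (intro compact_continuous_image smooth_fun_continuous_on smooth_fun_foldr smooth_bump compact_cball)
    then have "bounded (foldr partial_deriv is bump ` cball (0::real^'n) 1)"
      by (rule compact_imp_bounded)
    then obtain B where B: "\<And>x::real^'n. norm x \<le> 1 \<Longrightarrow> \<bar>foldr partial_deriv is bump x\<bar> \<le> B"
      unfolding bounded_iff by fastforce
    have "\<bar>foldr partial_deriv is bump x\<bar> \<le> B" for x :: "real^'n"
      using B[of x] B[of 0] foldr_partial_deriv_bump_outside[of x "is"]
      by (cases "norm x \<le> 1") auto
    then show ?thesis by blast
  qed
  then obtain M where M: "\<And>is x. \<bar>foldr partial_deriv is bump (x::real^'n)\<bar> \<le> M is"
    by metis
  let ?L = "{is :: 'n list. set is \<subseteq> UNIV \<and> length is \<le> m}"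
  have fin: "finite ?L" by (rule finite_lists_length_le) simp
  have pos: "0 \<le> M is" for "is"
    using M[of "is" 0] by linarith
  have "M is \<le> sum M ?L" if "length is \<le> m" for "is"
    using that by (intro member_le_sum fin) (auto simp: pos)
  with M have "\<bar>foldr partial_deriv is bump x\<bar> \<le> sum M ?L + 1" if "length is \<le> m" for "is" and x :: "real^'n"
    using that by (meson add_increasing2 order_trans zero_le_one)
  moreover have "0 < sum M ?L + 1" using pos by (simp add: sum_nonneg add_nonneg_pos)
  ultimately show ?thesis by blast
qed

section \<open>Integration by parts\<close>

lemma has_real_derivative_along_axis:
  fixes h :: "real^'n \<Rightarrow> real"
  assumes "h differentiable (at (x + s *\<^sub>R axis i 1))"
  shows "((\<lambda>s. h (x + s *\<^sub>R axis i 1)) has_real_derivative partial_deriv i h (x + s *\<^sub>R axis i 1)) (at s)"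
proof -
  let ?D = "frechet_derivative h (at (x + s *\<^sub>R axis i 1))"
  have D: "(h has_derivative ?D) (at (x + s *\<^sub>R axis i 1))"
    using assms frechet_derivative_works by blast
  have "((\<lambda>s. x + s *\<^sub>R axis i 1) has_derivative (\<lambda>t. t *\<^sub>R axis i 1)) (at s)"
    by (auto intro!: derivative_eq_intros)
  from has_derivative_compose[OF this D]
  have "((\<lambda>s. h (x + s *\<^sub>R axis i 1)) has_derivative (\<lambda>t. ?D (t *\<^sub>R axis i 1))) (at s)" .
  moreover have "(\<lambda>t. ?D (t *\<^sub>R axis i 1)) = (*) (partial_deriv i h (x + s *\<^sub>R axis i 1))"
    using linear_scale[OF has_derivative_linear[OF D]] by (auto simp: fun_eq_iff partial_deriv_def)
  ultimately show ?thesis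
    by (simp add: has_field_derivative_def)
qed

lemma lborel_integral_translate:
  fixes h :: "'a::euclidean_space \<Rightarrow> real"
  assumes "h \<in> borel_measurable borel"
  shows "(\<integral>x. h (x + c) \<partial>lborel) = (\<integral>x. h x \<partial>lborel)"
proof -
  have "(\<integral>x. h x \<partial>lborel) = (\<integral>x. h x \<partial>distr lborel borel ((+) c))"
    by (simp add: lborel_distr_plus)
  also have "\<dots> = (\<integral>x. h (c + x) \<partial>lborel)"
    by (rule integral_distr) (use assms in auto)
  finally show ?thesis by (simp add: add.commute)
qed

lemma lborel_integrable_translate:
  fixes h :: "'a::euclidean_space \<Rightarrow> real"
  assumes "integrable lborel h"
  shows "integrable lborel (\<lambda>x. h (x + c))"
proof -
  have "integrable (distr lborel borel ((+) c)) h"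
    using assms by (simp add: lborel_distr_plus)
  then have "integrable lborel (\<lambda>x. h (c + x))"
    by (subst (asm) integrable_distr_eq) (use assms in auto)
  then show ?thesis by (simp add: add.commute)
qed

lemma integrable_continuous_compact_support:
  fixes h :: "'a::euclidean_space \<Rightarrow> real"
  assumes "continuous_on UNIV h" "compact K" "\<And>x. x \<notin> K \<Longrightarrow> h x = 0"
  shows "integrable lborel h"
proof -
  have "integrable lborel (\<lambda>x. indicator K x *\<^sub>R h x)"
    by (intro borel_integrable_compact assms continuous_on_subset[OF assms(1)]) auto
  moreover have "(\<lambda>x. indicator K x *\<^sub>R h x) = h"
    using assms(3) by (auto simp: fun_eq_iff indicator_def)
  ultimately show ?thesis by simp
qed

lemma bounded_continuous_compact_support:
  fixes h :: "'a::euclidean_space \<Rightarrow> real"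
  assumes "continuous_on UNIV h" "compact K" "\<And>x. x \<notin> K \<Longrightarrow> h x = 0"
  obtains B where "0 \<le> B" "\<And>x. \<bar>h x\<bar> \<le> B"
proof -
  have "bounded (h ` K)"
    by (intro compact_imp_bounded compact_continuous_image assms continuous_on_subset[OF assms(1)]) auto
  then obtain B where B: "\<And>x. x \<in> K \<Longrightarrow> \<bar>h x\<bar> \<le> B"
    unfolding bounded_iff by fastforce
  show ?thesis
  proof (rule that[of "max B 0"])
    show "\<bar>h x\<bar> \<le> max B 0" for x
      using B[of x] assms(3)[of x] by (cases "x \<in> K") auto
  qed simp
qed

text \<open>
  The difference quotients \<open>q k\<close> have integral zero by translation invariance of Lebesgue measure; the
  mean value theorem bounds them, so dominated convergence applies.
\<close>
lemma integral_partial_deriv_eq_0: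
  fixes h :: "real^'n \<Rightarrow> real"
  assumes diff: "\<And>x. h differentiable (at x)"
    and cont: "continuous_on UNIV (partial_deriv i h)"
    and K: "compact K" "\<And>x. x \<notin> K \<Longrightarrow> h x = 0"
  shows "(\<integral>x. partial_deriv i h x \<partial>lborel) = 0"
proof -
  let ?e = "axis i (1::real) :: real^'n"
  define q where "q k x = real (Suc k) * (h (x + inverse (real (Suc k)) *\<^sub>R ?e) - h x)" for k x
  have conth: "continuous_on UNIV h"
    using diff by (meson continuous_at_imp_continuous_on differentiable_imp_continuous_within)
  have meas: "h \<in> borel_measurable borel"
    by (rule borel_measurable_continuous_onI[OF conth])
  have inth: "integrable lborel h"
    by (rule integrable_continuous_compact_support[OF conth K])
  have D0: "partial_deriv i h x = 0" if "x \<notin> K" for x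
    by (rule partial_deriv_outside[OF compact_imp_closed[OF K(1)] K(2) that])
  obtain B where B: "0 \<le> B" "\<And>x. \<bar>partial_deriv i h x\<bar> \<le> B"
    using bounded_continuous_compact_support[OF cont K(1) D0] by metis
  obtain b where b: "\<And>x. x \<in> K \<Longrightarrow> norm x \<le> b"
    using compact_imp_bounded[OF K(1)] unfolding bounded_iff by blast
  have deriv: "((\<lambda>s. h (x + s *\<^sub>R ?e)) has_real_derivative partial_deriv i h (x + s *\<^sub>R ?e)) (at s)"
    for x s
    by (rule has_real_derivative_along_axis[OF diff])
  have q_bound: "\<bar>q k x\<bar> \<le> B" for k x
  proof -
    let ?d = "inverse (real (Suc k))"
    obtain z where "h (x + ?d *\<^sub>R ?e) - h (x + 0 *\<^sub>R ?e) = (?d - 0) * partial_deriv i h (x + z *\<^sub>R ?e)"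
      using MVT2[of 0 ?d "\<lambda>s. h (x + s *\<^sub>R ?e)" "\<lambda>s. partial_deriv i h (x + s *\<^sub>R ?e)", OF _ deriv]
      by auto
    then have "q k x = partial_deriv i h (x + z *\<^sub>R ?e)"
      by (simp add: q_def)
    with B show ?thesis by simp
  qed
  \<comment> \<open>The translates have length at most 1, hence the enlarged radius.\<close>
  have q_0: "q k x = 0" if "x \<notin> cball 0 (b + 1)" for k x
  proof -
    let ?d = "inverse (real (Suc k))"
    have "norm (?d *\<^sub>R ?e) \<le> 1"
      by (simp add: norm_axis_1 inverse_le_1_iff)
    moreover have "norm x \<le> norm (x + ?d *\<^sub>R ?e) + norm (?d *\<^sub>R ?e)"
      by (metis add_diff_cancel norm_triangle_ineq4)
    ultimately have "x \<notin> K" "x + ?d *\<^sub>R ?e \<notin> K"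
      using that b[of x] b[of "x + ?d *\<^sub>R ?e"] by auto
    then show ?thesis by (simp add: q_def K(2))
  qed
  have q_lim: "(\<lambda>k. q k x) \<longlonglongrightarrow> partial_deriv i h x" for x
  proof -
    have "((\<lambda>t. (h (x + (0 + t) *\<^sub>R ?e) - h (x + 0 *\<^sub>R ?e)) / t) \<longlongrightarrow> partial_deriv i h (x + 0 *\<^sub>R ?e)) (at 0)"
      using deriv[of x 0] unfolding DERIV_def .
    moreover have "filterlim (\<lambda>k. inverse (real (Suc k))) (at 0) sequentially"
      by (intro filterlim_atI LIMSEQ_inverse_real_of_nat) auto
    ultimately have "(\<lambda>k. (h (x + (0 + inverse (real (Suc k))) *\<^sub>R ?e) - h (x + 0 *\<^sub>R ?e)) / inverse (real (Suc k)))
        \<longlonglongrightarrow> partial_deriv i h (x + 0 *\<^sub>R ?e)"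
      by (rule filterlim_compose)
    then show ?thesis
      by (simp add: q_def divide_inverse mult.commute)
  qed
  have q_meas: "q k \<in> borel_measurable borel" for k
    unfolding q_def using meas by measurable
  have "(\<integral>x. q k x \<partial>lborel) = 0" for k
    unfolding q_def
    by (simp add: Bochner_Integration.integral_diff lborel_integrable_translate inth
        lborel_integral_translate meas)
  moreover have "(\<lambda>k. \<integral>x. q k x \<partial>lborel) \<longlonglongrightarrow> (\<integral>x. partial_deriv i h x \<partial>lborel)"
  proof (rule integral_dominated_convergence)
    show "partial_deriv i h \<in> borel_measurable lborel"
      using borel_measurable_continuous_onI[OF cont] by simp
    show "integrable lborel (\<lambda>x::real^'n. B * indicat_real (cball 0 (b + 1)) x)"
      by (intro integrable_mult_right integrable_real_indicator) (use emeasure_compact_finite[of "cball (0::real^'n) (b + 1)"] in auto)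
    show "AE x in lborel. norm (q k x) \<le> B * indicat_real (cball 0 (b + 1)) x" for k
      using q_bound[of k] q_0[of _ k] by (intro AE_I2) (auto simp: indicator_def)
  qed (auto simp: q_meas q_lim)
  ultimately show ?thesis
    by (simp add: LIMSEQ_const_iff)
qed

lemma partial_deriv_mult:
  assumes "f differentiable (at x)" "g differentiable (at x)"
  shows "partial_deriv i (\<lambda>x. f x * g x) x = f x * partial_deriv i g x + partial_deriv i f x * g x"
proof -
  have "(f has_derivative frechet_derivative f (at x)) (at x)" "(g has_derivative frechet_derivative g (at x)) (at x)"
    using assms frechet_derivative_works by blast+
  from frechet_derivative_at[OF has_derivative_mult[OF this]]
  have "frechet_derivative (\<lambda>x. f x * g x) (at x) =
     (\<lambda>h. f x * frechet_derivative g (at x) h + frechet_derivative f (at x) h * g x)" by (rule sym)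
  then show ?thesis by (simp add: partial_deriv_def)
qed

lemma integral_by_parts_partial_deriv:
  fixes g \<psi> :: "real^'n \<Rightarrow> real"
  assumes g: "smooth_fun g" and \<psi>: "smooth_fun \<psi>" and K: "compact K" "\<And>x. x \<notin> K \<Longrightarrow> \<psi> x = 0"
  shows "(\<integral>x. g x * partial_deriv i \<psi> x \<partial>lborel) = - (\<integral>x. partial_deriv i g x * \<psi> x \<partial>lborel)"
proof -
  have eq: "partial_deriv i (\<lambda>x. g x * \<psi> x) = (\<lambda>x. g x * partial_deriv i \<psi> x + partial_deriv i g x * \<psi> x)"
    by (intro ext partial_deriv_mult smooth_fun_differentiable g \<psi>)
  note cont = smooth_fun_continuous_on[OF g] smooth_fun_continuous_on[OF \<psi>]
    smooth_fun_continuous_on[OF smooth_fun_partial_deriv[OF g]] smooth_fun_continuous_on[OF smooth_fun_partial_deriv[OF \<psi>]]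
  have "(\<integral>x. partial_deriv i (\<lambda>x. g x * \<psi> x) x \<partial>lborel) = 0"
  proof (rule integral_partial_deriv_eq_0[OF _ _ K(1)])
    show "(\<lambda>x. g x * \<psi> x) differentiable (at x)" for x
      by (intro differentiable_mult smooth_fun_differentiable g \<psi>)
    show "continuous_on UNIV (partial_deriv i (\<lambda>x. g x * \<psi> x))"
      unfolding eq by (intro continuous_intros cont)
  qed (simp add: K)
  moreover have "integrable lborel (\<lambda>x. g x * partial_deriv i \<psi> x)"
    using partial_deriv_outside[OF compact_imp_closed[OF K(1)] K(2)]
    by (intro integrable_continuous_compact_support[OF _ K(1)] continuous_intros cont) auto
  moreover have "integrable lborel (\<lambda>x. partial_deriv i g x * \<psi> x)"
    by (intro integrable_continuous_compact_support[OF _ K(1)] continuous_intros cont) (auto simp: K)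
  ultimately show ?thesis
    unfolding eq by simp
qed

text \<open>
  The outermost derivative moves first and ends up innermost on the other factor. The reversed word is
  kept as it is rather than reordered by the symmetry of higher derivatives.
\<close>
lemma integral_by_parts_foldr:
  fixes g \<psi> :: "real^'n \<Rightarrow> real"
  assumes g: "smooth_fun g" and \<psi>: "smooth_fun \<psi>" and K: "compact K" "\<And>x. x \<notin> K \<Longrightarrow> \<psi> x = 0"
  shows "(\<integral>x. g x * foldr partial_deriv is \<psi> x \<partial>lborel) =
    (- 1) ^ length is * (\<integral>x. foldr partial_deriv (rev is) g x * \<psi> x \<partial>lborel)"
  using g
proof (induction "is" arbitrary: g)
  case (Cons i "is")
  have "(\<integral>x. g x * foldr partial_deriv (i # is) \<psi> x \<partial>lborel) =
      - (\<integral>x. partial_deriv i g x * foldr partial_deriv is \<psi> x \<partial>lborel)"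
    using integral_by_parts_partial_deriv[OF Cons.prems smooth_fun_foldr[OF \<psi>] K(1)
        foldr_partial_deriv_outside[OF compact_imp_closed[OF K(1)] K(2)]]
    by simp
  then show ?case
    using Cons.IH[OF smooth_fun_partial_deriv[OF Cons.prems]] by simp
qed simp

section \<open>Weak derivatives of smooth functions\<close>

text \<open>A multi-index as the word in which each coordinate is repeated according to its multiplicity.\<close>
definition multi_list :: "('n::finite \<Rightarrow> nat) \<Rightarrow> 'n list" where
  "multi_list \<alpha> = concat (map (\<lambda>i. replicate (\<alpha> i) i) coordinates)"

lemma coordinates: "distinct (coordinates :: 'n::finite list)" "set (coordinates :: 'n list) = UNIV"
proof -
  have "\<exists>is :: 'n list. distinct is \<and> set is = UNIV"
    using finite_distinct_list[of "UNIV :: 'n set"] by auto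
  then have "distinct (coordinates :: 'n list) \<and> set (coordinates :: 'n list) = UNIV"
    unfolding coordinates_def by (rule someI_ex)
  then show "distinct (coordinates :: 'n::finite list)" "set (coordinates :: 'n list) = UNIV" by auto
qed

lemma length_multi_list: "length (multi_list \<alpha>) = multi_order \<alpha>"
proof -
  have "length (multi_list \<alpha>) = (\<Sum>i\<leftarrow>coordinates. \<alpha> i)"
    by (simp add: multi_list_def length_concat o_def)
  also have "\<dots> = (\<Sum>i\<in>set coordinates. \<alpha> i)"
    by (rule sum_list_distinct_conv_sum_set[OF coordinates(1)])
  finally show ?thesis by (simp add: coordinates multi_order_def)
qed

lemma multi_deriv_eq_foldr:
  fixes f :: "real^'n \<Rightarrow> real"
  shows "multi_deriv \<alpha> f = foldr partial_deriv (multi_list \<alpha>) f"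
proof -
  have rep: "foldr partial_deriv (replicate k i) g = (partial_deriv i ^^ k) g" for k and i :: 'n and g :: "real^'n \<Rightarrow> real"
    by (induction k) auto
  have "foldr (\<lambda>i g. (partial_deriv i ^^ \<alpha> i) g) is f =
      foldr partial_deriv (concat (map (\<lambda>i. replicate (\<alpha> i) i) is)) f" for "is" :: "'n list"
    by (induction "is") (auto simp: rep)
  then show ?thesis by (simp add: multi_deriv_def multi_list_def)
qed

lemma lebesgue_on_integral_eq_lborel:
  fixes f :: "real^'n \<Rightarrow> real"
  assumes "f \<in> borel_measurable borel" "\<Omega> \<in> sets lebesgue" "\<And>x. x \<notin> \<Omega> \<Longrightarrow> f x = 0"
  shows "(\<integral>x. f x \<partial>lebesgue_on \<Omega>) = (\<integral>x. f x \<partial>lborel)"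
proof -
  have "(\<integral>x. f x \<partial>lebesgue_on \<Omega>) = (\<integral>x. indicator \<Omega> x *\<^sub>R f x \<partial>lebesgue)"
    by (rule integral_restrict_space) (use assms in auto)
  also have "(\<lambda>x. indicator \<Omega> x *\<^sub>R f x) = f"
    using assms(3) by (auto simp: fun_eq_iff indicator_def)
  also have "(\<integral>x. f x \<partial>lebesgue) = (\<integral>x. f x \<partial>lborel)"
    by (rule integral_completion) (use assms in auto)
  finally show ?thesis .
qed

lemma locally_integrable_continuous:
  fixes f :: "real^'n \<Rightarrow> real"
  assumes "continuous_on UNIV f"
  shows "locally_integrable \<Omega> f"
  unfolding locally_integrable_def
proof safe
  fix K :: "(real^'n) set" assume K: "compact K"
  have "integrable lborel (\<lambda>x. indicator K x *\<^sub>R f x)"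
    by (intro borel_integrable_compact K continuous_on_subset[OF assms]) auto
  then have "integrable lebesgue (\<lambda>x. indicator K x *\<^sub>R f x)"
    by (subst integrable_completion) auto
  then show "integrable (lebesgue_on K) f"
    by (subst integrable_restrict_space) (use K in \<open>auto simp: borel_compact\<close>)
qed

lemma test_functionE:
  assumes "\<phi> \<in> test_functions \<Omega>"
  obtains K where "smooth_fun \<phi>" "compact K" "K \<subseteq> \<Omega>" "\<And>x. x \<notin> K \<Longrightarrow> \<phi> x = 0"
proof
  show "\<phi> x = 0" if "x \<notin> closure {x. \<phi> x \<noteq> 0}" for x
    using that closure_subset[of "{x. \<phi> x \<noteq> 0}"] by blast
qed (use assms in \<open>auto simp: test_functions_def\<close>)

lemma has_weak_deriv_smooth_fun:
  fixes u :: "real^'n \<Rightarrow> real"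
  assumes u: "smooth_fun u" and \<Omega>: "open \<Omega>"
  shows "has_weak_deriv \<Omega> \<alpha> u (foldr partial_deriv (rev (multi_list \<alpha>)) u)"
  unfolding has_weak_deriv_def
proof (intro conjI ballI)
  let ?v = "foldr partial_deriv (rev (multi_list \<alpha>)) u"
  show "locally_integrable \<Omega> u" "locally_integrable \<Omega> ?v"
    by (intro locally_integrable_continuous smooth_fun_continuous_on smooth_fun_foldr u)+
  fix \<phi> :: "real^'n \<Rightarrow> real" assume "\<phi> \<in> test_functions \<Omega>"
  then obtain K where \<phi>: "smooth_fun \<phi>" and K: "compact K" "K \<subseteq> \<Omega>"
    and out: "\<And>x. x \<notin> K \<Longrightarrow> \<phi> x = 0"
    by (rule test_functionE) blast
  have out': "multi_deriv \<alpha> \<phi> x = 0" if "x \<notin> K" for x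
    unfolding multi_deriv_eq_foldr
    by (rule foldr_partial_deriv_outside[OF compact_imp_closed[OF K(1)] out that])
  have \<Omega>': "\<Omega> \<in> sets lebesgue" using \<Omega> by auto
  have meas: "u \<in> borel_measurable borel" "?v \<in> borel_measurable borel" "\<phi> \<in> borel_measurable borel"
    "multi_deriv \<alpha> \<phi> \<in> borel_measurable borel"
    using smooth_fun_borel_measurable[OF u] smooth_fun_borel_measurable[OF smooth_fun_foldr[OF u, of "rev (multi_list \<alpha>)"]]
      smooth_fun_borel_measurable[OF \<phi>] smooth_fun_borel_measurable[OF smooth_fun_foldr[OF \<phi>, of "multi_list \<alpha>"]]
    by (simp_all only: multi_deriv_eq_foldr)
  have 1: "(\<integral>x. u x * multi_deriv \<alpha> \<phi> x \<partial>lebesgue_on \<Omega>) = (\<integral>x. u x * multi_deriv \<alpha> \<phi> x \<partial>lborel)"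
    using out' K(2) \<Omega>' meas by (intro lebesgue_on_integral_eq_lborel) auto
  have 2: "(\<integral>x. ?v x * \<phi> x \<partial>lebesgue_on \<Omega>) = (\<integral>x. ?v x * \<phi> x \<partial>lborel)"
    using out K(2) \<Omega>' meas by (intro lebesgue_on_integral_eq_lborel) auto
  have 3: "(\<integral>x. u x * foldr partial_deriv (multi_list \<alpha>) \<phi> x \<partial>lborel) =
      (- 1) ^ length (multi_list \<alpha>) * (\<integral>x. ?v x * \<phi> x \<partial>lborel)"
    by (rule integral_by_parts_foldr[OF u \<phi> K(1)]) (rule out)
  show "(\<integral>x. u x * multi_deriv \<alpha> \<phi> x \<partial>lebesgue_on \<Omega>) =
      (-1) ^ multi_order \<alpha> * (\<integral>x. ?v x * \<phi> x \<partial>lebesgue_on \<Omega>)"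
    unfolding 1 2 using 3 by (simp only: multi_deriv_eq_foldr length_multi_list)
qed

section \<open>Uniqueness of weak derivatives\<close>

text \<open>
  For \<open>t > 0\<close> one has \<open>exp (-1 / (k t)) \<longlonglongrightarrow> 1\<close>, so products over the coordinates of
  \<open>flat 0 (k (x\<^sub>i - a\<^sub>i) (b\<^sub>i - x\<^sub>i))\<close> tend to the indicator of the open box, with values in \<open>[0, 1]\<close>.
\<close>
lemma box_indicator_limit_of_test_functions:
  fixes a b :: "real^'n"
  assumes ab: "\<And>i. a $ i < b $ i" and sub: "cbox a b \<subseteq> \<Omega>"
  obtains \<phi> where "\<And>k. \<phi> k \<in> test_functions \<Omega>" "\<And>k x. \<bar>\<phi> k x\<bar> \<le> 1" "\<And>k x. x \<notin> cbox a b \<Longrightarrow> \<phi> k x = 0"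
    "\<And>x. (\<lambda>k. \<phi> k x) \<longlonglongrightarrow> indicator (box a b) x"
proof
  define P where "P i x = (x $ i - a $ i) * (b $ i - x $ i)" for i and x :: "real^'n"
  define \<phi> where "\<phi> k x = (\<Prod>i\<in>UNIV. flat 0 (real (Suc k) * P i x))" for k and x :: "real^'n"
  have P_pos: "0 < P i x \<longleftrightarrow> a $ i < x $ i \<and> x $ i < b $ i" for i x
    using ab[of i] by (auto simp: P_def zero_less_mult_iff)
  have "\<phi> k \<in> smooth_terms" for k
    unfolding \<phi>_def[abs_def] P_def[abs_def]
    by (intro smooth_terms_prod smooth_terms.flat smooth_terms.mult[OF smooth_terms.const]
       smooth_terms.mult[OF smooth_terms_minus smooth_terms_minus] smooth_terms.const smooth_terms.coord) simp
  then have smooth: "smooth_fun (\<phi> k)" for k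
    by (rule smooth_fun_smooth_terms)
  have outside: "\<phi> k x = 0" if out: "x \<notin> box a b" for k x
  proof -
    obtain i where "\<not> 0 < P i x"
      using out by (auto simp: mem_box_cart P_pos)
    then have "real (Suc k) * P i x \<le> 0"
      by (intro mult_nonneg_nonpos) auto
    then have "flat 0 (real (Suc k) * P i x) = 0"
      unfolding flat_def by (simp only: if_True)
    then show ?thesis
      unfolding \<phi>_def by (intro prod_zero) auto
  qed
  show "\<phi> k x = 0" if "x \<notin> cbox a b" for k x
    using that box_subset_cbox by (blast intro: outside)
  show "\<phi> k \<in> test_functions \<Omega>" for k
  proof -
    have "{x. \<phi> k x \<noteq> 0} \<subseteq> cbox a b"
      using outside[of _ k] box_subset_cbox by blast
    then have cl: "closure {x. \<phi> k x \<noteq> 0} \<subseteq> cbox a b"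
      by (rule closure_minimal[OF _ closed_cbox])
    then have "compact (closure {x. \<phi> k x \<noteq> 0})"
      by (meson bounded_cbox bounded_subset closed_closure compact_eq_bounded_closed)
    with cl sub smooth show ?thesis by (auto simp: test_functions_def)
  qed
  show "\<bar>\<phi> k x\<bar> \<le> 1" for k x
    unfolding \<phi>_def by (simp add: abs_prod flat_nonneg prod_le_1 flat_0_le_1)
  have lim1: "(\<lambda>k. flat 0 (real (Suc k) * t)) \<longlonglongrightarrow> 1" if t: "0 < t" for t
  proof -
    have "(\<lambda>k. exp (- (inverse (real (Suc k)) * inverse t))) \<longlonglongrightarrow> exp (- (0 * inverse t))"
      by (intro tendsto_intros LIMSEQ_inverse_real_of_nat)
    moreover have "flat 0 (real (Suc k) * t) = exp (- (inverse (real (Suc k)) * inverse t))" for k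
    proof -
      have "\<not> real (Suc k) * t \<le> 0" using t by (simp add: not_le)
      then show ?thesis by (simp only: flat_def if_False) (simp add: divide_inverse)
    qed
    ultimately show ?thesis by simp
  qed
  show "(\<lambda>k. \<phi> k x) \<longlonglongrightarrow> indicator (box a b) x" for x
  proof (cases "x \<in> box a b")
    case True
    then have "(\<lambda>k. \<phi> k x) \<longlonglongrightarrow> (\<Prod>i\<in>(UNIV :: 'n set). 1)"
      unfolding \<phi>_def by (intro tendsto_prod lim1) (auto simp: mem_box_cart P_pos)
    with True show ?thesis by simp
  qed (simp add: outside)
qed

text \<open>
  Boxes form a generator of the Borel sets that is stable under intersections, so the measures with the
  positive and the negative part of \<open>G\<close> as densities coincide; hence so do the densities.
\<close>
lemma AE_zero_of_integral_boxes_zero: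
  fixes G :: "'a::euclidean_space \<Rightarrow> real"
  assumes G: "integrable lebesgue G"
    and zero: "\<And>c d. (\<integral>x. indicator (box c d) x * G x \<partial>lebesgue) = 0"
  shows "AE x in lebesgue. G x = 0"
proof -
  obtain g where g: "g \<in> borel_measurable lborel" and eq: "AE x in lborel. G x = g x"
    using completion_ex_borel_measurable_real[OF borel_measurable_integrable[OF G]] by blast
  have eq': "AE x in lebesgue. G x = g x"
    using eq by (rule AE_completion)
  have intg: "integrable lborel g"
  proof -
    have "integrable lebesgue g"
      using integrable_cong_AE[OF borel_measurable_integrable[OF G] measurable_completion[OF g] eq'] G by blast
    then show ?thesis by (rule integrable_completion[OF g, THEN iffD1])
  qed
  have int0: "(\<integral>x. indicator (box c d) x * g x \<partial>lborel) = 0" for c d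
  proof -
    have "(\<integral>x. indicator (box c d) x * g x \<partial>lborel) = (\<integral>x. indicator (box c d) x * g x \<partial>lebesgue)"
      using g by (intro integral_completion[symmetric]) auto
    also have "\<dots> = (\<integral>x. indicator (box c d) x * G x \<partial>lebesgue)"
      using eq' measurable_completion[OF g] borel_measurable_integrable[OF G]
      by (intro integral_cong_AE borel_measurable_times borel_measurable_indicator) auto
    finally show ?thesis by (simp add: zero)
  qed
  let ?p = "\<lambda>x. ennreal (g x)" and ?n = "\<lambda>x. ennreal (- g x)"
  have box_eq: "emeasure (density lborel ?p) (box c d) = emeasure (density lborel ?n) (box c d)"
    and box_fin: "emeasure (density lborel ?p) (box c d) \<noteq> \<infinity>" for c d
  proof -
    let ?f = "\<lambda>x. indicator (box c d) x * g x"
    have f: "integrable lborel ?f"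
      using integrable_mult_indicator[OF _ intg, of "box c d"] by simp
    note fin = real_integrable_def[THEN iffD1, OF f]
    have "emeasure (density lborel ?p) (box c d) = (\<integral>\<^sup>+ x. ennreal (?f x) \<partial>lborel)"
      using g by (subst emeasure_density) (auto intro!: nn_integral_cong simp: indicator_def)
    moreover have "emeasure (density lborel ?n) (box c d) = (\<integral>\<^sup>+ x. ennreal (- ?f x) \<partial>lborel)"
      using g by (subst emeasure_density) (auto intro!: nn_integral_cong simp: indicator_def)
    moreover have "enn2real (\<integral>\<^sup>+ x. ennreal (?f x) \<partial>lborel) = enn2real (\<integral>\<^sup>+ x. ennreal (- ?f x) \<partial>lborel)"
      using real_lebesgue_integral_def[OF f] int0[of c d] by simp
    ultimately show "emeasure (density lborel ?p) (box c d) = emeasure (density lborel ?n) (box c d)"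
        "emeasure (density lborel ?p) (box c d) \<noteq> \<infinity>"
      using fin by (auto simp: less_top[symmetric]) (metis ennreal_enn2real_if)
  qed
  have "density lborel ?p = density lborel ?n"
  proof (rule measure_eqI_generator_eq)
    let ?E = "range (\<lambda>(a, b). box a b::'a set)"
    show "Int_stable ?E"
      by (auto simp: Int_stable_def box_Int_box)
    show "?E \<subseteq> Pow UNIV" "sets (density lborel ?p) = sigma_sets UNIV ?E" "sets (density lborel ?n) = sigma_sets UNIV ?E"
      by (simp_all add: borel_eq_box)
    let ?A = "\<lambda>n::nat. box (- (real n *\<^sub>R One)) (real n *\<^sub>R One) :: 'a set"
    show "range ?A \<subseteq> ?E" "(\<Union>i. ?A i) = UNIV"
      unfolding UN_box_eq_UNIV by auto
    show "emeasure (density lborel ?p) (?A i) \<noteq> \<infinity>" for i by (rule box_fin)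
    show "emeasure (density lborel ?p) X = emeasure (density lborel ?n) X" if "X \<in> ?E" for X
      using that box_eq by auto
  qed
  then have "AE x in lborel. ?p x = ?n x"
    using g by (intro sigma_finite_measure.density_unique[OF sigma_finite_lborel]) auto
  then have "AE x in lborel. g x = 0"
    by eventually_elim (metis ennreal_eq_0_iff ennreal_neg linorder_linear neg_le_0_iff_le antisym)
  then have "AE x in lebesgue. g x = 0"
    by (rule AE_completion)
  with eq' show ?thesis
    by eventually_elim simp
qed

lemma integral_box_eq_0_of_test_functions:
  fixes w :: "real^'n \<Rightarrow> real"
  assumes w: "locally_integrable \<Omega> w" and \<Omega>: "open \<Omega>"
    and zero: "\<And>\<phi>. \<phi> \<in> test_functions \<Omega> \<Longrightarrow> (\<integral>x. w x * \<phi> x \<partial>lebesgue_on \<Omega>) = 0"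
    and sub: "cbox a b \<subseteq> \<Omega>"
  shows "(\<integral>x. indicator (box a b) x * w x \<partial>lebesgue) = 0"
proof (cases "box a b = {}")
  case False
  then have ab: "a $ i < b $ i" for i
    by (auto simp: interval_eq_empty_cart not_le)
  obtain \<phi> where \<phi>: "\<And>k. \<phi> k \<in> test_functions \<Omega>" "\<And>k x. \<bar>\<phi> k x\<bar> \<le> 1" "\<And>k x. x \<notin> cbox a b \<Longrightarrow> \<phi> k x = 0"
    "\<And>x. (\<lambda>k. \<phi> k x) \<longlonglongrightarrow> indicator (box a b) x"
    using box_indicator_limit_of_test_functions[OF ab sub] by metis
  have "integrable (lebesgue_on (cbox a b)) w"
    using w sub unfolding locally_integrable_def by auto
  then have W: "integrable lebesgue (\<lambda>x. indicator (cbox a b) x * w x)"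
    by (subst (asm) integrable_restrict_space) auto
  have meas: "\<phi> k \<in> borel_measurable lebesgue" for k
    using \<phi>(1)[of k] by (intro measurable_completion) (auto simp: test_functions_def smooth_fun_borel_measurable)
  have "(\<lambda>k. \<integral>x. (indicator (cbox a b) x * w x) * \<phi> k x \<partial>lebesgue) \<longlonglongrightarrow> (\<integral>x. indicator (box a b) x * w x \<partial>lebesgue)"
  proof (rule integral_dominated_convergence)
    show "(\<lambda>x. indicator (box a b) x * w x) \<in> borel_measurable lebesgue"
    proof -
      have "(\<lambda>x. indicator (box a b) x * w x) = (\<lambda>x. indicator (box a b) x * (indicator (cbox a b) x * w x))"
        using box_subset_cbox[of a b] by (auto simp: fun_eq_iff indicator_def)
      also have "\<dots> \<in> borel_measurable lebesgue"
        by (intro borel_measurable_times borel_measurable_indicator borel_measurable_integrable[OF W]) auto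
      finally show ?thesis .
    qed
    show "(\<lambda>x. indicator (cbox a b) x * w x * \<phi> k x) \<in> borel_measurable lebesgue" for k
      by (intro borel_measurable_times[OF borel_measurable_integrable[OF W] meas])
    show "integrable lebesgue (\<lambda>x. \<bar>indicator (cbox a b) x * w x\<bar>)"
      by (rule integrable_abs[OF W])
    show "AE x in lebesgue. (\<lambda>k. indicator (cbox a b) x * w x * \<phi> k x) \<longlonglongrightarrow> indicator (box a b) x * w x"
    proof (intro AE_I2)
      fix x
      have "(\<lambda>k. indicator (cbox a b) x * w x * \<phi> k x) \<longlonglongrightarrow> indicator (cbox a b) x * w x * indicator (box a b) x"
        by (intro tendsto_mult_left \<phi>)
      moreover have "indicator (cbox a b) x * w x * indicator (box a b) x = indicator (box a b) x * w x"
        using box_subset_cbox[of a b] by (auto simp: indicator_def)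
      ultimately show "(\<lambda>k. indicator (cbox a b) x * w x * \<phi> k x) \<longlonglongrightarrow> indicator (box a b) x * w x" by simp
    qed
    show "AE x in lebesgue. norm (indicator (cbox a b) x * w x * \<phi> k x) \<le> \<bar>indicator (cbox a b) x * w x\<bar>" for k
    proof (intro AE_I2)
      fix x
      show "norm (indicator (cbox a b) x * w x * \<phi> k x) \<le> \<bar>indicator (cbox a b) x * w x\<bar>"
        using mult_left_mono[OF \<phi>(2)[of k x] abs_ge_zero[of "indicator (cbox a b) x * w x"]]
        by (simp add: abs_mult)
    qed
  qed
  moreover have "(\<integral>x. (indicator (cbox a b) x * w x) * \<phi> k x \<partial>lebesgue) = 0" for k
  proof -
    have "(\<integral>x. w x * \<phi> k x \<partial>lebesgue_on \<Omega>) = (\<integral>x. indicator \<Omega> x *\<^sub>R (w x * \<phi> k x) \<partial>lebesgue)"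
      using \<Omega> by (intro integral_restrict_space) auto
    also have "\<dots> = (\<integral>x. (indicator (cbox a b) x * w x) * \<phi> k x \<partial>lebesgue)"
      using \<phi>(3) sub by (intro Bochner_Integration.integral_cong refl) (auto simp: indicator_def)
    finally show ?thesis using zero[OF \<phi>(1)] by simp
  qed
  ultimately show ?thesis by (simp add: LIMSEQ_const_iff)
qed simp

text \<open>
  The fundamental lemma of the calculus of variations. On each closed box in \<open>\<Omega>\<close> the function is
  integrable with vanishing integrals over all subboxes, and countably many such boxes cover \<open>\<Omega>\<close>.
\<close>
lemma AE_zero_of_test_functions:
  fixes w :: "real^'n \<Rightarrow> real"
  assumes w: "locally_integrable \<Omega> w" and \<Omega>: "open \<Omega>"
    and zero: "\<And>\<phi>. \<phi> \<in> test_functions \<Omega> \<Longrightarrow> (\<integral>x. w x * \<phi> x \<partial>lebesgue_on \<Omega>) = 0"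
  shows "AE x in lebesgue. x \<in> \<Omega> \<longrightarrow> w x = 0"
proof -
  have on_cbox: "AE x in lebesgue. x \<in> cbox a b \<longrightarrow> w x = 0" if sub: "cbox a b \<subseteq> \<Omega>" for a b
  proof -
    have "integrable (lebesgue_on (cbox a b)) w"
      using w sub unfolding locally_integrable_def by auto
    then have W: "integrable lebesgue (\<lambda>x. indicator (cbox a b) x * w x)"
      by (subst (asm) integrable_restrict_space) auto
    have eq: "(\<lambda>x. indicator (box a b) x * w x) = (\<lambda>x. indicator (box a b) x *\<^sub>R (indicator (cbox a b) x * w x))"
      using box_subset_cbox[of a b] by (auto simp: fun_eq_iff indicator_def)
    have "integrable lebesgue (\<lambda>x. indicator (box a b) x * w x)"
      by (subst eq) (rule integrable_mult_indicator[OF _ W], auto)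
    moreover have "(\<integral>x. indicator (box c d) x * (indicator (box a b) x * w x) \<partial>lebesgue) = 0" for c d
    proof -
      obtain e f where ef: "box c d \<inter> box a b = box e f"
        unfolding box_Int_box by blast
      have "box e f \<subseteq> cbox a b"
        using ef box_subset_cbox by blast
      then have "closure (box e f) \<subseteq> cbox a b"
        by (rule closure_minimal[OF _ closed_cbox])
      then have "box e f = {} \<or> cbox e f \<subseteq> \<Omega>"
        using sub by (cases "box e f = {}") (auto simp: closure_box)
      then have "(\<integral>x. indicator (box e f) x * w x \<partial>lebesgue) = 0"
        using integral_box_eq_0_of_test_functions[OF w \<Omega> zero, of e f] by auto
      moreover have "(\<lambda>x. indicator (box c d) x * (indicator (box a b) x * w x)) = (\<lambda>x. indicator (box e f) x * w x)"
        unfolding ef[symmetric] by (simp add: indicator_inter_arith fun_eq_iff)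
      ultimately show ?thesis by simp
    qed
    ultimately have "AE x in lebesgue. indicator (box a b) x * w x = 0"
      by (rule AE_zero_of_integral_boxes_zero)
    moreover have "AE x in lebesgue. x \<notin> cbox a b - box a b"
      using negligible_frontier_interval[of a b] by (intro AE_not_in) (simp add: negligible_iff_null_sets)
    ultimately show ?thesis
      by eventually_elim (auto simp: indicator_def split: if_splits)
  qed
  obtain \<D> where D: "countable \<D>" "\<D> \<subseteq> Pow \<Omega>" "\<And>X. X \<in> \<D> \<Longrightarrow> \<exists>a b. X = cbox a b" "\<Union>\<D> = \<Omega>"
    by (rule open_countable_Union_open_cbox[OF \<Omega>]) (rule that)
  have "AE x in lebesgue. \<forall>X\<in>\<D>. x \<in> X \<longrightarrow> w x = 0"
  proof (subst AE_ball_countable[OF D(1)], intro ballI)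
    fix X assume "X \<in> \<D>"
    then show "AE x in lebesgue. x \<in> X \<longrightarrow> w x = 0"
      using D(2) D(3)[of X] on_cbox by blast
  qed
  then show ?thesis
    by eventually_elim (use D(4) in blast)
qed

lemma integrable_times_test_function:
  fixes v :: "real^'n \<Rightarrow> real"
  assumes v: "locally_integrable \<Omega> v" and \<Omega>: "open \<Omega>" and \<phi>: "\<phi> \<in> test_functions \<Omega>"
  shows "integrable (lebesgue_on \<Omega>) (\<lambda>x. v x * \<phi> x)"
proof -
  obtain K where K: "smooth_fun \<phi>" "compact K" "K \<subseteq> \<Omega>" "\<And>x. x \<notin> K \<Longrightarrow> \<phi> x = 0"
    using test_functionE[OF \<phi>] by blast
  obtain B where B: "\<And>x. \<bar>\<phi> x\<bar> \<le> B"
    using bounded_continuous_compact_support[OF smooth_fun_continuous_on[OF K(1)] K(2,4)] by metis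
  have "integrable (lebesgue_on K) v"
    using v K unfolding locally_integrable_def by auto
  then have V: "integrable lebesgue (\<lambda>x. indicator K x * v x)"
    using K(2) by (subst (asm) integrable_restrict_space) (auto simp: borel_compact)
  have "integrable lebesgue (\<lambda>x. (indicator K x * v x) * \<phi> x)"
  proof (rule Bochner_Integration.integrable_bound)
    show "integrable lebesgue (\<lambda>x. B * (indicator K x * v x))"
      by (intro integrable_mult_right V)
    show "(\<lambda>x. indicator K x * v x * \<phi> x) \<in> borel_measurable lebesgue"
      by (intro borel_measurable_times[OF borel_measurable_integrable[OF V]] measurable_completion)
         (simp add: smooth_fun_borel_measurable K)
    have "0 \<le> B" using B[of 0] by linarith
    then show "AE x in lebesgue. norm (indicator K x * v x * \<phi> x) \<le> norm (B * (indicator K x * v x))"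
      using B by (intro AE_I2) (auto simp: abs_mult mult.commute intro!: mult_mono)
  qed
  moreover have "(\<lambda>x. (indicator K x * v x) * \<phi> x) = (\<lambda>x. indicator \<Omega> x *\<^sub>R (v x * \<phi> x))"
    using K(3,4) by (auto simp: fun_eq_iff indicator_def)
  ultimately show ?thesis
    using \<Omega> by (subst integrable_restrict_space) auto
qed

lemma has_weak_deriv_unique:
  fixes u v v' :: "real^'n \<Rightarrow> real"
  assumes v: "has_weak_deriv \<Omega> \<alpha> u v" and v': "has_weak_deriv \<Omega> \<alpha> u v'" and \<Omega>: "open \<Omega>"
  shows "AE x in lebesgue. x \<in> \<Omega> \<longrightarrow> v x = v' x"
proof -
  have loc: "locally_integrable \<Omega> v" "locally_integrable \<Omega> v'"
    using v v' by (auto simp: has_weak_deriv_def)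
  have "AE x in lebesgue. x \<in> \<Omega> \<longrightarrow> v x - v' x = 0"
  proof (rule AE_zero_of_test_functions[OF _ \<Omega>])
    show "locally_integrable \<Omega> (\<lambda>x. v x - v' x)"
      using loc unfolding locally_integrable_def by auto
    fix \<phi> :: "real^'n \<Rightarrow> real" assume \<phi>: "\<phi> \<in> test_functions \<Omega>"
    have "(\<integral>x. v x * \<phi> x \<partial>lebesgue_on \<Omega>) = (\<integral>x. v' x * \<phi> x \<partial>lebesgue_on \<Omega>)"
      using v v' \<phi> unfolding has_weak_deriv_def by simp
    then show "(\<integral>x. (v x - v' x) * \<phi> x \<partial>lebesgue_on \<Omega>) = 0"
      using integrable_times_test_function[OF loc(1) \<Omega> \<phi>] integrable_times_test_function[OF loc(2) \<Omega> \<phi>]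
      by (simp add: left_diff_distrib)
  qed
  then show ?thesis by eventually_elim simp
qed

lemma weak_deriv_smooth_fun:
  fixes u :: "real^'n \<Rightarrow> real"
  assumes u: "smooth_fun u" and \<Omega>: "open \<Omega>"
  shows "AE x in lebesgue. x \<in> \<Omega> \<longrightarrow> foldr partial_deriv (rev (multi_list \<alpha>)) u x = weak_deriv \<Omega> \<alpha> u x"
proof -
  have "has_weak_deriv \<Omega> \<alpha> u (weak_deriv \<Omega> \<alpha> u)"
    unfolding weak_deriv_def by (rule someI[of "has_weak_deriv \<Omega> \<alpha> u"]) (rule has_weak_deriv_smooth_fun[OF u \<Omega>])
  then show ?thesis
    by (intro has_weak_deriv_unique[OF has_weak_deriv_smooth_fun[OF u \<Omega>] _ \<Omega>])
qed

text \<open>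
  Local integrability alone gives measurability on compact sets only; on \<open>\<Omega>\<close> it comes from the almost
  everywhere equal classical derivative and completeness of Lebesgue measure.
\<close>
lemma weak_deriv_smooth_fun_measurable:
  fixes u :: "real^'n \<Rightarrow> real"
  assumes u: "smooth_fun u" and \<Omega>: "open \<Omega>"
  shows "weak_deriv \<Omega> \<alpha> u \<in> borel_measurable (lebesgue_on \<Omega>)"
proof -
  let ?v = "foldr partial_deriv (rev (multi_list \<alpha>)) u"
  have "?v \<in> borel_measurable borel"
    by (rule smooth_fun_borel_measurable[OF smooth_fun_foldr[OF u]])
  then have "(\<lambda>x. indicator \<Omega> x * ?v x) \<in> borel_measurable lebesgue"
    using \<Omega> by (intro borel_measurable_times measurable_completion) auto
  moreover have "AE x in lebesgue. indicator \<Omega> x * ?v x = indicator \<Omega> x * weak_deriv \<Omega> \<alpha> u x"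
    using weak_deriv_smooth_fun[OF u \<Omega>, of \<alpha>] by eventually_elim (auto simp: indicator_def)
  ultimately have "(\<lambda>x. indicator \<Omega> x * weak_deriv \<Omega> \<alpha> u x) \<in> borel_measurable lebesgue"
    by (rule borel_measurable_AE)
  then show ?thesis
    using \<Omega> by (subst borel_measurable_restrict_space_iff) (auto simp: mult.commute)
qed

section \<open>Young functions\<close>

lemma borel_measurable_mono_indicator:
  fixes f :: "real \<Rightarrow> ennreal"
  assumes f: "mono_on {0..} f" and S: "S \<subseteq> {0..}" "S \<in> sets borel"
  shows "(\<lambda>x. f x * indicator S x) \<in> borel_measurable borel"
proof -
  have "(\<lambda>x. f (max 0 x)) \<in> borel_measurable borel"
  proof (rule borel_measurableI_greater)
    fix y
    have "is_interval {x. y < f (max 0 x)}"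
      unfolding is_interval_1
    proof safe
      fix a b x assume "y < f (max 0 a)" "a \<le> x"
      moreover have "f (max 0 a) \<le> f (max 0 x)" if "a \<le> x"
        using that by (intro mono_onD[OF f]) auto
      ultimately show "y < f (max 0 x)" by (auto intro: less_le_trans)
    qed
    then show "{x \<in> space borel. y < f (max 0 x)} \<in> sets borel"
      using real_interval_borel_measurable by simp
  qed
  then have "(\<lambda>x. f (max 0 x) * indicator S x) \<in> borel_measurable borel"
    using S by measurable
  moreover have "(\<lambda>x. f (max 0 x) * indicator S x) = (\<lambda>x. f x * indicator S x)"
    using S by (force simp: fun_eq_iff indicator_def max_def)
  ultimately show ?thesis by simp
qed

lemma young_mono_on:
  assumes "young_function A"
  shows "mono_on {0..} A"
proof -
  obtain a where a: "\<forall>s\<ge>0. A s = (\<integral>\<^sup>+ r\<in>{0..s}. a r \<partial>lborel)"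
    using assms unfolding young_function_def by blast
  show ?thesis
    by (intro mono_onI) (auto simp: a intro!: nn_set_integral_set_mono)
qed

lemmas young_mono = young_mono_on[THEN mono_onD]

lemma nn_integral_const_interval:
  "a \<le> b \<Longrightarrow> (\<integral>\<^sup>+ x\<in>{a..b}. c \<partial>lborel) = c * ennreal (b - a)"
  "a \<le> b \<Longrightarrow> (\<integral>\<^sup>+ x\<in>{a<..b}. c \<partial>lborel) = c * ennreal (b - a)"
  by (simp_all add: nn_integral_cmult_indicator)

lemma young_zero:
  assumes "young_function A"
  shows "A 0 = 0"
proof -
  obtain a where a: "\<forall>s\<ge>0. A s = (\<integral>\<^sup>+ r\<in>{0..s}. a r \<partial>lborel)"
    using assms unfolding young_function_def by blast
  have "A 0 = (\<integral>\<^sup>+ r\<in>{0..0}. a r \<partial>lborel)" by (rule a[rule_format]) simp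
  also have "\<dots> = (\<integral>\<^sup>+ r\<in>{0..0::real}. a 0 \<partial>lborel)"
    by (intro nn_integral_cong) (auto simp: indicator_def)
  also have "\<dots> = a 0 * emeasure lborel {0..0::real}"
    by (rule nn_integral_cmult_indicator) simp
  finally show ?thesis by simp
qed

text \<open>
  The part of convexity that the argument uses. As \<open>a\<close> increases, \<open>A(l s)\<close> is at most \<open>l s a(l s)\<close>, while
  the integral of \<open>a\<close> from \<open>l s\<close> to \<open>s\<close> is at least \<open>(1 - l) s a(l s)\<close>; weighting the two bounds by
  \<open>1 - l\<close> and \<open>l\<close> gives the claim.
\<close>
lemma young_scale:
  assumes A: "young_function A" and l: "0 \<le> l" "l \<le> 1" and s: "0 \<le> s"
  shows "A (l * s) \<le> ennreal l * A s"
proof -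
  obtain a where mono: "mono_on {0..} a" and a: "\<forall>s\<ge>0. A s = (\<integral>\<^sup>+ r\<in>{0..s}. a r \<partial>lborel)"
    using A unfolding young_function_def by blast
  let ?c = "a (l * s)"
  have ls: "l * s \<le> s" using l s by (simp add: mult_left_le_one_le)
  have ls0: "0 \<le> l * s" using l s by simp
  have "A (l * s) = (\<integral>\<^sup>+ r\<in>{0..l * s}. a r \<partial>lborel)"
    using ls0 by (simp add: a)
  also have "\<dots> \<le> (\<integral>\<^sup>+ r\<in>{0..l * s}. ?c \<partial>lborel)"
    by (intro nn_integral_mono) (auto simp: indicator_def intro!: mono_onD[OF mono])
  finally have up: "A (l * s) \<le> ?c * ennreal (l * s)"
    using ls0 by (simp add: nn_integral_const_interval)
  have As: "A s = (\<integral>\<^sup>+ r. a r * indicator {0..l * s} r + a r * indicator {l * s<..s} r \<partial>lborel)"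
    using s ls ls0 by (simp add: a) (intro nn_integral_cong, auto simp: indicator_def)
  have split: "\<dots> = A (l * s) + (\<integral>\<^sup>+ r\<in>{l * s<..s}. a r \<partial>lborel)"
    using ls0 by (subst nn_integral_add) (auto simp: a intro!: borel_measurable_mono_indicator[OF mono])
  have "(\<integral>\<^sup>+ r\<in>{l * s<..s}. ?c \<partial>lborel) \<le> (\<integral>\<^sup>+ r\<in>{l * s<..s}. a r \<partial>lborel)"
    using ls0 by (intro nn_integral_mono) (auto simp: indicator_def intro!: mono_onD[OF mono])
  then have low: "A (l * s) + ?c * ennreal (s - l * s) \<le> A s"
    using ls unfolding As split by (simp add: nn_integral_const_interval add_left_mono)
  have "A (l * s) = ennreal l * A (l * s) + ennreal (1 - l) * A (l * s)"
    using l by (simp add: distrib_right[symmetric] ennreal_plus[symmetric] del: ennreal_plus)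
  also have "\<dots> \<le> ennreal l * A (l * s) + ennreal (1 - l) * (?c * ennreal (l * s))"
    by (intro add_left_mono mult_left_mono up) auto
  also have "ennreal (1 - l) * (?c * ennreal (l * s)) = ennreal l * (?c * ennreal (s - l * s))"
  proof -
    have "ennreal (1 - l) * ennreal (l * s) = ennreal l * ennreal (s - l * s)"
      using l s ls ls0 by (simp add: ennreal_mult[symmetric] algebra_simps)
    then show ?thesis by (metis mult.assoc mult.commute)
  qed
  also have "ennreal l * A (l * s) + ennreal l * (?c * ennreal (s - l * s)) \<le> ennreal l * A s"
    using low by (simp add: distrib_left[symmetric] mult_left_mono)
  finally show ?thesis .
qed

lemma young_finite_somewhere:
  assumes "young_function A"
  shows "\<exists>\<rho>>0. A \<rho> < \<infinity>"
proof -
  obtain a \<rho> where mono: "mono_on {0..} a" and a: "\<forall>s\<ge>0. A s = (\<integral>\<^sup>+ r\<in>{0..s}. a r \<partial>lborel)"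
    and \<rho>: "\<rho> > 0" "a \<rho> \<noteq> \<infinity>"
    using assms unfolding young_function_def by blast
  have "A \<rho> \<le> (\<integral>\<^sup>+ r\<in>{0..\<rho>}. a \<rho> \<partial>lborel)"
    using \<rho> by (simp add: a) (intro nn_integral_mono, auto simp: indicator_def intro!: mono_onD[OF mono])
  also have "\<dots> < \<infinity>"
    using \<rho> by (simp add: nn_integral_const_interval ennreal_mult_less_top less_top)
  finally show ?thesis using \<rho> by blast
qed

text \<open>By \<open>young_scale\<close> with \<open>l = 1/k\<close>, \<open>A(k) \<ge> k A(1)\<close>.\<close>
lemma young_unbounded:
  assumes A: "young_function A" and pos: "A 1 > 0" and y: "y < \<infinity>"
  shows "\<exists>s\<ge>1. y < A s"
proof -
  define c where "c = (if A 1 = \<infinity> then 1 else enn2real (A 1))"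
  have c: "0 < c" "ennreal c \<le> A 1"
    using pos by (auto simp: c_def enn2real_positive_iff less_top)
  obtain k where k: "1 \<le> k" "enn2real y < k * c"
  proof -
    obtain j where "enn2real y < real j * c"
      using reals_Archimedean3[OF c(1)] by blast
    then have "enn2real y < max 1 (real j) * c"
      using c(1) by (smt (verit) mult_right_mono)
    then show ?thesis using that[of "max 1 (real j)"] by simp
  qed
  have "A ((1 / k) * k) \<le> ennreal (1 / k) * A k"
    using k by (intro young_scale[OF A]) auto
  then have "ennreal c \<le> ennreal (1 / k) * A k"
    using c(2) k by simp
  then have "ennreal k * ennreal c \<le> ennreal k * (ennreal (1 / k) * A k)"
    by (rule mult_left_mono) simp
  also have "\<dots> = A k"
    using k by (simp add: mult.assoc[symmetric] ennreal_mult[symmetric])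
  finally have "ennreal (k * c) \<le> A k"
    using k c by (simp add: ennreal_mult)
  moreover have "y < ennreal (k * c)"
    using y k(2) by (cases y) (auto simp: ennreal_less_iff)
  ultimately show ?thesis using k(1) by (intro exI[of _ k]) auto
qed

text \<open>
  If \<open>A\<close> vanished at one point, it would vanish on the whole interval from the origin to that point,
  where \<open>s / A(s)\<close> would then be infinite.
\<close>
lemma young_positive:
  assumes A: "young_function A" and nm: "0 < m" "m < n"
    and \<epsilon>: "\<epsilon> > 0" "(\<integral>\<^sup>+ s\<in>{0..\<epsilon>}. sobolev_integrand n m A s \<partial>lborel) < \<infinity>"
    and s: "s > 0"
  shows "A s > 0"
proof (rule ccontr)
  assume "\<not> A s > 0"
  then have A0: "A s = 0" by simp
  define d where "d = min s \<epsilon>"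
  have d: "0 < d" "d \<le> s" "d \<le> \<epsilon>" using s \<epsilon> by (auto simp: d_def)
  have inf: "sobolev_integrand n m A r = \<infinity>" if "r \<in> {0<..d}" for r
  proof -
    have "A r \<le> A s" using that d s by (intro young_mono[OF A]) auto
    with A0 that show ?thesis by (simp add: sobolev_integrand_def ennreal_powr_def)
  qed
  have "(\<integral>\<^sup>+ r\<in>{0<..d}. \<infinity> \<partial>lborel) \<le> (\<integral>\<^sup>+ s\<in>{0..\<epsilon>}. sobolev_integrand n m A s \<partial>lborel)"
    using d by (intro nn_integral_mono) (auto simp: indicator_def inf)
  then have "\<infinity> * ennreal (d - 0) < (\<infinity> :: ennreal)"
    using \<epsilon>(2) d by (subst (asm) nn_integral_const_interval) (auto simp: less_top)
  then show False using d by (simp add: ennreal_top_mult)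
qed

section \<open>The upper Boyd index\<close>

lemma ennreal_divide_le_1: "x \<le> y \<Longrightarrow> x / y \<le> (1::ennreal)"
proof -
  assume "x \<le> y"
  then have "x / y \<le> y / y" by (rule divide_right_mono_ennreal)
  also have "y / y \<le> 1"
    by (cases "y = 0 \<or> y = top") (auto simp: less_top[symmetric])
  finally show ?thesis .
qed

lemma right_inverse_mono: "r \<le> s \<Longrightarrow> right_inverse A r \<le> right_inverse A s"
  unfolding right_inverse_def
  by (intro INF_superset_mono) (auto intro: le_less_trans ennreal_leI)

lemma right_inverse_le: "0 \<le> s \<Longrightarrow> ennreal r < A s \<Longrightarrow> right_inverse A r \<le> ennreal s"
  unfolding right_inverse_def by (rule INF_lower) simp

text \<open>
  The dual of \<open>young_scale\<close>: if \<open>A(s') > s t\<close> then \<open>A(s'/t) > s\<close>.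
\<close>
lemma right_inverse_scale:
  assumes A: "young_function A" and t: "0 < t" "t < 1"
  shows "ennreal t * right_inverse A s \<le> right_inverse A (s * t)"
  unfolding right_inverse_def[of A "s * t"]
proof (rule INF_greatest)
  fix s' assume "s' \<in> {s'. 0 \<le> s' \<and> ennreal (s * t) < A s'}"
  then have s': "0 \<le> s'" "ennreal (s * t) < A s'" by auto
  have "ennreal t * ennreal s = ennreal (s * t)"
    using t by (simp add: ennreal_mult''[symmetric] mult.commute)
  also have "\<dots> < A (t * (s' / t))" using s' t by simp
  also have "\<dots> \<le> ennreal t * A (s' / t)"
    using t s' by (intro young_scale[OF A]) auto
  finally have "ennreal s < A (s' / t)"
    using mult_left_mono[of "A (s' / t)" "ennreal s" "ennreal t"] by (auto simp: not_le[symmetric])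
  then have "right_inverse A s \<le> ennreal (s' / t)"
    using t s' by (intro right_inverse_le) auto
  then have "ennreal t * right_inverse A s \<le> ennreal t * ennreal (s' / t)"
    by (rule mult_left_mono) simp
  also have "\<dots> = ennreal s'"
    using t s' by (simp add: ennreal_mult[symmetric])
  finally show "ennreal t * right_inverse A s \<le> ennreal s'" .
qed

text \<open>
  The inverse is finite because \<open>A\<close> is unbounded, and it is eventually at least any \<open>\<rho>\<close> at which \<open>A\<close> is
  finite. This allows passing to real numbers.
\<close>
lemma right_inverse_eventually_positive:
  assumes A: "young_function A" and pos: "A 1 > 0"
  obtains R S where "0 < S" "\<And>s. s \<ge> S \<Longrightarrow> right_inverse A s = ennreal (R s) \<and> 0 < R s"
proof -
  obtain \<rho> where \<rho>: "\<rho> > 0" "A \<rho> < \<infinity>" using young_finite_somewhere[OF A] by blast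
  define R where "R s = enn2real (right_inverse A s)" for s
  have "right_inverse A s = ennreal (R s) \<and> 0 < R s" if s: "s \<ge> enn2real (A \<rho>) + 1" for s
  proof -
    have "A \<rho> = ennreal (enn2real (A \<rho>))" using \<rho> by (simp add: less_top)
    also have "\<dots> \<le> ennreal s" using s by (intro ennreal_leI) simp
    finally have "ennreal \<rho> \<le> right_inverse A s"
      unfolding right_inverse_def
    proof (intro INF_greatest)
      fix s' assume s': "s' \<in> {s'. 0 \<le> s' \<and> ennreal s < A s'}" and "A \<rho> \<le> ennreal s"
      then have "A \<rho> < A s'" by auto
      then have "\<rho> \<le> s'"
        using young_mono[OF A, of s' \<rho>] s' \<rho> by (force simp: not_le[symmetric])
      then show "ennreal \<rho> \<le> ennreal s'" by (rule ennreal_leI)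
    qed
    moreover obtain s' where "s' \<ge> 1" "ennreal s < A s'"
      using young_unbounded[OF A pos, of "ennreal s"] by auto
    then have "right_inverse A s \<le> ennreal s'" by (intro right_inverse_le) auto
    ultimately show ?thesis
      using \<rho> unfolding R_def
      by (cases "right_inverse A s") (auto simp: top_unique)
  qed
  then show ?thesis
    by (intro that[of "enn2real (A \<rho>) + 1"]) (auto simp: add_nonneg_pos)
qed

text \<open>
  The bounds \<open>t \<le> h(t) \<le> 1\<close> make the quotient of logarithms meaningful: it is below \<open>p\<close> exactly when
  \<open>h(t) powr p < t\<close>, and \<open>\<sigma>\<close> is chosen between \<open>h(t)\<close> and \<open>t powr (1/p)\<close>. The upper limit then supplies
  the contraction for all large arguments.
\<close>
lemma boyd_index_contraction:
  assumes A: "young_function A" and pos: "A 1 > 0" and p: "0 < p"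
    and I: "upper_boyd_index A < ereal p"
  obtains \<sigma> t R S where "0 < \<sigma>" "\<sigma> < 1" "0 < t" "t < 1" "\<sigma> powr p < t" "0 < S"
    "\<And>s. s \<ge> S \<Longrightarrow> right_inverse A s = ennreal (R s)" "\<And>s. s \<ge> S \<Longrightarrow> 0 < R s"
    "\<And>s. s * t \<ge> S \<Longrightarrow> R (s * t) < \<sigma> * R s"
proof -
  obtain R S where S: "0 < S" and R: "\<And>s. s \<ge> S \<Longrightarrow> right_inverse A s = ennreal (R s) \<and> 0 < R s"
    using right_inverse_eventually_positive[OF A pos] by metis
  from I obtain t where t: "0 < t" "t < 1"
    and ht: "(if boyd_h A t = 1 then \<infinity> else ereal (ln t / ln (enn2real (boyd_h A t)))) < ereal p"
    unfolding upper_boyd_index_def INF_less_iff by auto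
  define h where "h = enn2real (boyd_h A t)"
  have "boyd_h A t \<le> 1"
    unfolding boyd_h_def
  proof (rule Limsup_bounded)
    show "\<forall>\<^sub>F s in at_top. right_inverse A (s * t) / right_inverse A s \<le> 1"
      using eventually_gt_at_top[of 0]
    proof eventually_elim
      fix s :: real assume "0 < s"
      then show "right_inverse A (s * t) / right_inverse A s \<le> 1"
        using t by (intro ennreal_divide_le_1 right_inverse_mono mult_right_le_one_le) auto
    qed
  qed
  moreover have "ennreal t \<le> boyd_h A t"
    unfolding boyd_h_def
  proof (rule le_Limsup)
    show "\<forall>\<^sub>F s in at_top. ennreal t \<le> right_inverse A (s * t) / right_inverse A s"
      using eventually_ge_at_top[of "S / t"]
    proof eventually_elim
      fix s assume "S / t \<le> s"
      then have st: "S \<le> s * t" using t by (simp add: divide_le_eq)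
      moreover have "0 < s" using st S t zero_less_mult_pos2[of s t] by linarith
      then have "s * t \<le> s" using t by (intro mult_right_le_one_le) auto
      ultimately have "S \<le> s" by linarith
      note Rs = R[OF st] R[OF this]
      have "ennreal (t * R s) \<le> ennreal (R (s * t))"
        using right_inverse_scale[OF A t, of s] Rs t by (simp add: ennreal_mult)
      then have "t * R s \<le> R (s * t)"
        using Rs by (subst (asm) ennreal_le_iff) auto
      then show "ennreal t \<le> right_inverse A (s * t) / right_inverse A s"
        using Rs by (simp add: divide_ennreal le_divide_eq)
    qed
  qed simp
  moreover have "boyd_h A t \<noteq> 1" using ht by auto
  ultimately have h: "boyd_h A t = ennreal h" "t \<le> h" "h < 1"
  proof -
    assume *: "boyd_h A t \<le> 1" "ennreal t \<le> boyd_h A t" "boyd_h A t \<noteq> 1"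
    then have "boyd_h A t \<noteq> top" by (auto simp: top_unique)
    then show eq: "boyd_h A t = ennreal h" by (simp add: h_def less_top)
    have "0 \<le> h" by (simp add: h_def)
    with * t show "t \<le> h" "h < 1"
      unfolding eq by (auto simp: less_le)
  qed
  have "ln t / ln h < p" using ht by (simp add: h_def[symmetric] split: if_splits)
  moreover have "ln h < 0" using h t by simp
  ultimately have "p * ln h < ln t" by (simp add: divide_less_eq)
  then have "ln h < ln t / p" using p by (simp add: field_simps)
  then have "exp (ln h) < exp (ln t / p)" by simp
  then have hq: "h < t powr (1 / p)" using h t by (simp add: powr_def)
  have "t powr (1 / p) < 1 powr (1 / p)"
    using t p by (intro powr_less_mono2) auto
  then have q1: "t powr (1 / p) < 1" by simp
  obtain \<sigma> where \<sigma>: "h < \<sigma>" "\<sigma> < t powr (1 / p)" using dense[OF hq] by blast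
  have \<sigma>01: "0 < \<sigma>" "\<sigma> < 1" using \<sigma> h t q1 by auto
  have "\<sigma> powr p < (t powr (1 / p)) powr p"
    using \<sigma> \<sigma>01 p by (intro powr_less_mono2) auto
  then have \<sigma>p: "\<sigma> powr p < t" using t p by (simp add: powr_powr)
  have "boyd_h A t < ennreal \<sigma>" using h \<sigma> t by (simp add: ennreal_less_iff)
  then have "\<forall>\<^sub>F s in at_top. right_inverse A (s * t) / right_inverse A s < ennreal \<sigma>"
    unfolding boyd_h_def by (rule Limsup_lessD)
  then obtain S' where S': "\<And>s. s \<ge> S' \<Longrightarrow> right_inverse A (s * t) / right_inverse A s < ennreal \<sigma>"
    unfolding eventually_at_top_linorder by blast
  show ?thesis
  proof (rule that[of \<sigma> t "max S S'" R])
    show "R (s * t) < \<sigma> * R s" if s: "max S S' \<le> s * t" for s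
    proof -
      have "0 < s" using s S t zero_less_mult_pos2[of s t] by linarith
      then have "s * t \<le> s" using t by (intro mult_right_le_one_le) auto
      then have "S \<le> s" "S' \<le> s" "S \<le> s * t" using s by auto
      then have "ennreal (R (s * t)) / ennreal (R s) < ennreal \<sigma>" "0 < R s" "0 < R (s * t)"
        using R S'[of s] by auto
      then have "R (s * t) / R s < \<sigma>"
        by (simp add: divide_ennreal ennreal_less_iff)
      then show ?thesis using \<open>0 < R s\<close> by (simp add: divide_less_eq mult.commute)
    qed
    show "right_inverse A s = ennreal (R s)" "0 < R s" if "max S S' \<le> s" for s
      using R[of s] that by auto
  qed (use \<sigma>01 t \<sigma>p S in auto)
qed

text \<open>
  If \<open>A\<close> were infinite somewhere, its inverse would be bounded, and the contraction would force the
  supremum \<open>L\<close> of the inverse to satisfy \<open>L \<le> \<sigma> L\<close>. Where \<open>A\<close> is finite and positive, \<open>young_scale\<close>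
  makes it strictly increasing, so the inverse at \<open>A(a)\<close> is at most \<open>a\<close>, and the contraction at \<open>A(a)\<close> can be read back as
  growth of \<open>A\<close>.
\<close>
lemma boyd_index_growth:
  assumes A: "young_function A" and pos: "\<And>s. s > 0 \<Longrightarrow> A s > 0" and p: "0 < p"
    and I: "upper_boyd_index A < ereal p"
  obtains \<sigma> t a\<^sub>0 where "0 < \<sigma>" "\<sigma> < 1" "0 < t" "t < 1" "\<sigma> powr p < t" "0 < a\<^sub>0"
    "\<And>s. s \<ge> 0 \<Longrightarrow> A s < \<infinity>" "\<And>a. a \<ge> a\<^sub>0 \<Longrightarrow> ennreal t * A a \<le> A (\<sigma> * a)"
proof -
  have pos1: "A 1 > 0" by (rule pos) simp
  obtain \<sigma> t R S where \<sigma>t: "0 < \<sigma>" "\<sigma> < 1" "0 < t" "t < 1" "\<sigma> powr p < t" and S: "0 < S"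
    and R: "\<And>s. s \<ge> S \<Longrightarrow> right_inverse A s = ennreal (R s)" "\<And>s. s \<ge> S \<Longrightarrow> 0 < R s"
    and contr: "\<And>s. s * t \<ge> S \<Longrightarrow> R (s * t) < \<sigma> * R s"
    using boyd_index_contraction[OF A pos1 p I] by metis
  have St: "S \<le> s * t \<Longrightarrow> S \<le> s" for s
  proof -
    assume *: "S \<le> s * t"
    then have "0 < s" using S \<sigma>t zero_less_mult_pos2[of s t] by linarith
    then have "s * t \<le> s" using \<sigma>t by (intro mult_right_le_one_le) auto
    with * show ?thesis by linarith
  qed
  have fin: "A s < \<infinity>" if s: "s \<ge> 0" for s
  proof (rule ccontr)
    assume "\<not> A s < \<infinity>"
    then have inf: "A s = \<infinity>" by (simp add: less_top[symmetric])
    have bound: "R r \<le> s" if "S \<le> r" for r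
    proof -
      have "right_inverse A r \<le> ennreal s" by (intro right_inverse_le s) (simp add: inf)
      then show ?thesis using R[OF that] s by simp
    qed
    let ?L = "Sup (R ` {S..})"
    have bdd: "bdd_above (R ` {S..})" using bound by (intro bdd_aboveI[of _ s]) auto
    have "R r \<le> \<sigma> * ?L" if r: "r \<in> {S..}" for r
    proof -
      have rt: "r / t * t = r" using \<sigma>t by simp
      have "R r < \<sigma> * R (r / t)" using contr[of "r / t"] rt r by simp
      also have "S \<le> r / t" using St[of "r / t"] rt r by simp
      then have "\<sigma> * R (r / t) \<le> \<sigma> * ?L"
        using \<sigma>t by (intro mult_left_mono cSup_upper bdd) auto
      finally show ?thesis by simp
    qed
    then have "?L \<le> \<sigma> * ?L" by (intro cSup_least) auto
    moreover have "R S \<le> ?L" by (intro cSup_upper bdd) auto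
    then have "0 < ?L" using R(2)[of S] by simp
    ultimately show False using \<sigma>t by simp
  qed
  obtain a\<^sub>0 where a0: "a\<^sub>0 \<ge> 1" "ennreal (S / t) < A a\<^sub>0"
    using young_unbounded[OF A pos1, of "ennreal (S / t)"] by auto
  have main: "ennreal t * A a \<le> A (\<sigma> * a)" if a: "a \<ge> a\<^sub>0" for a
  proof -
    define b where "b = enn2real (A a)"
    have b: "A a = ennreal b" using fin[of a] a a0 by (simp add: b_def less_top)
    have "ennreal (S / t) < A a"
      using a0 a young_mono[OF A, of a\<^sub>0 a] by (auto intro: less_le_trans)
    moreover have St0: "0 < S / t" using S \<sigma>t by simp
    ultimately have "S / t < b" by (simp add: b ennreal_less_iff)
    then have Sb: "S \<le> b * t" "0 < b"
      using St0 \<sigma>t by (simp add: divide_less_eq, linarith)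
    have "R b \<le> c" if c: "a < c" for c
    proof -
      have "A a = A ((a / c) * c)" using c a a0 by simp
      also have "\<dots> \<le> ennreal (a / c) * A c" using c a a0 by (intro young_scale[OF A]) auto
      also have "\<dots> < A c"
      proof -
        define e where "e = enn2real (A c)"
        have e: "A c = ennreal e" "0 < e"
          using fin[of c] pos[of c] c a a0 by (auto simp: e_def less_top enn2real_positive_iff)
        then have "a / c * e < 1 * e" using c a a0 by (intro mult_strict_right_mono) auto
        then show ?thesis using e c a a0 by (simp add: ennreal_mult[symmetric] ennreal_less_iff)
      qed
      finally have "right_inverse A b \<le> ennreal c"
        using c a a0 by (intro right_inverse_le) (auto simp: b)
      then show ?thesis using R[OF St[OF Sb(1)]] c a a0 by simp
    qed
    then have "R b \<le> a" by (rule dense_ge)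
    then have "\<sigma> * R b \<le> \<sigma> * a" using \<sigma>t by simp
    with contr[OF Sb(1)] have "R (b * t) < \<sigma> * a" by simp
    then have "right_inverse A (b * t) < ennreal (\<sigma> * a)"
      using R[OF Sb(1)] by (simp add: ennreal_less_iff)
    then obtain s' where s': "0 \<le> s'" "ennreal (b * t) < A s'" "ennreal s' < ennreal (\<sigma> * a)"
      unfolding right_inverse_def INF_less_iff by auto
    have "A s' \<le> A (\<sigma> * a)"
      using s' by (intro young_mono[OF A]) (auto simp: ennreal_less_iff)
    moreover have "ennreal t * A a = ennreal (b * t)"
      using \<sigma>t Sb by (simp add: b ennreal_mult[symmetric] mult.commute)
    ultimately show ?thesis using s' by simp
  qed
  show ?thesis
  proof (rule that[OF \<sigma>t])
    show "0 < a\<^sub>0" using a0 by simp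
  qed (fact fin main)+
qed

section \<open>The Sobolev conjugate at infinity\<close>

text \<open>
  Here \<open>J\<close> is the integral of a decreasing function \<open>\<psi>\<close>. When the radius grows by the factor \<open>1/\<sigma>\<close>, the
  quantity \<open>r \<psi>(r)\<close> grows at least by \<open>1 / (\<sigma> \<kappa>) > 1\<close>, so the integral behaves like a geometric series
  dominated by its last shell. The proof is an induction over the shells
  \<open>a\<^sub>0 / \<sigma>\<^sup>j < r \<le> a\<^sub>0 / \<sigma>\<^sup>j\<^sup>+\<^sup>1\<close>; the constant only has to cover the first shell and satisfy
  \<open>C \<sigma> \<kappa> + \<kappa> \<le> C\<close>.
\<close>
lemma integral_le_const_times_self:
  fixes J \<psi> :: "real \<Rightarrow> real"
  assumes \<sigma>: "0 < \<sigma>" "\<sigma> < 1" and a0: "0 < a\<^sub>0" and \<kappa>: "0 \<le> \<kappa>" "\<sigma> * \<kappa> < 1"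
    and J_mono: "\<And>\<rho> r. 0 < \<rho> \<Longrightarrow> \<rho> \<le> r \<Longrightarrow> J \<rho> \<le> J r"
    and J_step: "\<And>\<rho> r. 0 < \<rho> \<Longrightarrow> \<rho> \<le> r \<Longrightarrow> J r \<le> J \<rho> + (r - \<rho>) * \<psi> \<rho>"
    and \<psi>_pos: "\<And>r. 0 < r \<Longrightarrow> 0 < \<psi> r"
    and \<psi>_anti: "\<And>\<rho> r. 0 < \<rho> \<Longrightarrow> \<rho> \<le> r \<Longrightarrow> \<psi> r \<le> \<psi> \<rho>"
    and \<psi>_growth: "\<And>r. a\<^sub>0 \<le> r \<Longrightarrow> \<psi> (\<sigma> * r) \<le> \<kappa> * \<psi> r"
  shows "\<exists>C>0. \<forall>r\<ge>a\<^sub>0. J r \<le> C * (r * \<psi> r)"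
proof -
  define b where "b = a\<^sub>0 / \<sigma>"
  have b: "a\<^sub>0 \<le> b" "0 < b" using \<sigma> a0 by (auto simp: b_def le_divide_eq mult_left_le)
  \<comment> \<open>The two quotients cover the first shell and the step from one shell to the next.\<close>
  define C where "C = max 1 (max (J b / (a\<^sub>0 * \<psi> b)) (\<kappa> / (1 - \<sigma> * \<kappa>)))"
  have "1 \<le> C" by (simp add: C_def)
  have Cb: "J b \<le> C * (a\<^sub>0 * \<psi> b)"
  proof -
    have "J b / (a\<^sub>0 * \<psi> b) \<le> C" by (simp add: C_def)
    then show ?thesis using a0 \<psi>_pos[OF b(2)] by (simp add: divide_le_eq)
  qed
  have C\<kappa>: "C * (\<sigma> * \<kappa>) + \<kappa> \<le> C"
  proof -
    have "\<kappa> / (1 - \<sigma> * \<kappa>) \<le> C" by (simp add: C_def)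
    then show ?thesis using \<kappa> by (simp add: divide_le_eq algebra_simps)
  qed
  have first_shell: "J r \<le> C * (r * \<psi> r)" if r: "a\<^sub>0 \<le> r" "r \<le> b" for r
  proof -
    have "J r \<le> J b" using r a0 by (intro J_mono) auto
    also have "\<dots> \<le> C * (a\<^sub>0 * \<psi> b)" by (rule Cb)
    also have "\<dots> \<le> C * (r * \<psi> r)"
      using r a0 \<open>1 \<le> C\<close> \<psi>_pos[OF b(2)] \<psi>_anti[of r b] by (intro mult_left_mono mult_mono) auto
    finally show ?thesis .
  qed
  have "J r \<le> C * (r * \<psi> r)" if "a\<^sub>0 \<le> r" "r \<le> a\<^sub>0 / \<sigma> ^ Suc j" for j r
    using that
  proof (induction j arbitrary: r)
    case 0
    then show ?case by (intro first_shell) (auto simp: b_def)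
  next
    case (Suc j)
    show ?case
    proof (cases "r \<le> b")
      case True
      then show ?thesis using Suc.prems by (intro first_shell)
    next
      case False
      have r0: "0 < r" using Suc.prems a0 by simp
      have sr: "a\<^sub>0 \<le> \<sigma> * r" using False \<sigma> by (simp add: b_def not_le divide_less_eq mult.commute)
      have "\<sigma> * r \<le> a\<^sub>0 / \<sigma> ^ Suc j"
        using Suc.prems(2) \<sigma> by (simp add: field_simps)
      then have IH: "J (\<sigma> * r) \<le> C * (\<sigma> * r * \<psi> (\<sigma> * r))" by (rule Suc.IH[OF sr])
      have "\<sigma> * r \<le> r" using \<sigma> r0 by simp
      then have "J r \<le> J (\<sigma> * r) + (r - \<sigma> * r) * \<psi> (\<sigma> * r)"
        using sr a0 by (intro J_step) auto
      also have "\<dots> \<le> C * (\<sigma> * r * \<psi> (\<sigma> * r)) + r * \<psi> (\<sigma> * r)"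
        using IH \<sigma> r0 \<psi>_pos[of "\<sigma> * r"] by (intro add_mono mult_right_mono) auto
      also have "\<dots> = (C * \<sigma> * r + r) * \<psi> (\<sigma> * r)" by (simp add: algebra_simps)
      also have "\<dots> \<le> (C * \<sigma> * r + r) * (\<kappa> * \<psi> r)"
        using \<psi>_growth[of r] Suc.prems \<sigma> r0 \<open>1 \<le> C\<close> by (intro mult_left_mono) auto
      also have "\<dots> = (C * (\<sigma> * \<kappa>) + \<kappa>) * (r * \<psi> r)" by (simp add: algebra_simps)
      also have "\<dots> \<le> C * (r * \<psi> r)"
        using C\<kappa> r0 \<psi>_pos[OF r0] by (intro mult_right_mono) auto
      finally show ?thesis .
    qed
  qed
  moreover have "\<exists>j. r \<le> a\<^sub>0 / \<sigma> ^ Suc j" if "a\<^sub>0 \<le> r" for r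
  proof -
    have r0: "0 < r" using that a0 by simp
    then obtain j where "\<sigma> ^ j < a\<^sub>0 / r"
      using real_arch_pow_inv[of "a\<^sub>0 / r" \<sigma>] \<sigma> a0 by auto
    moreover have "\<sigma> ^ Suc j \<le> \<sigma> ^ j" using \<sigma> by (intro power_decreasing) auto
    ultimately have "\<sigma> ^ Suc j * r \<le> a\<^sub>0"
      using r0 by (simp add: less_divide_eq) (smt (verit) mult_right_mono)
    then show ?thesis using \<sigma> by (auto simp: le_divide_eq mult.commute)
  qed
  ultimately show ?thesis using \<open>1 \<le> C\<close> by (intro exI[of _ C]) force
qed

lemma ennreal_powr_ennreal: "0 \<le> x \<Longrightarrow> ennreal_powr (ennreal x) p = ennreal (x powr p)"
  by (simp add: ennreal_powr_def)

lemma measurable_ennreal_powr [measurable]: "(\<lambda>x. ennreal_powr x p) \<in> borel_measurable borel"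
  unfolding ennreal_powr_def by measurable

lemma sobolev_integrand_measurable:
  assumes A: "young_function A" and S: "S \<subseteq> {0..}" "S \<in> sets borel"
  shows "(\<lambda>s. sobolev_integrand n m A s * indicator S s) \<in> borel_measurable borel"
proof -
  have [measurable]: "(\<lambda>s. A s * indicator S s) \<in> borel_measurable borel"
    by (rule borel_measurable_mono_indicator[OF young_mono_on[OF A] S])
  have [measurable]: "(\<lambda>x. ennreal_powr (x::ennreal) (real m / (real n - real m))) \<in> borel_measurable borel"
    by (rule measurable_ennreal_powr)
  have "(\<lambda>s. ennreal_powr (ennreal s / (A s * indicator S s)) (real m / (real n - real m)) * indicator S s)
      \<in> borel_measurable borel"
    using S(2) by measurable
  also have "(\<lambda>s. ennreal_powr (ennreal s / (A s * indicator S s)) (real m / (real n - real m)) * indicator S s) =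
      (\<lambda>s. sobolev_integrand n m A s * indicator S s)"
    by (auto simp: fun_eq_iff sobolev_integrand_def indicator_def)
  finally show ?thesis .
qed

text \<open>
  With \<open>q = m/(n-m)\<close> the integrand is \<open>\<psi>(s) = (s / A(s)) powr q\<close>, decreasing by \<open>young_scale\<close>. The growth
  condition gives \<open>\<psi>(\<sigma>r) \<le> (\<sigma>/t) powr q \<sqdot> \<psi>(r)\<close>, and since \<open>(n/m) q = 1 + q\<close>, the condition
  \<open>\<sigma> powr (n/m) < t\<close> is exactly \<open>\<sigma> \<sqdot> (\<sigma>/t) powr q < 1\<close>.
\<close>
lemma sobolev_H_upper_bound:
  fixes A :: "real \<Rightarrow> ennreal"
  defines "B \<equiv> \<lambda>s. enn2real (A s)"
  assumes A: "young_function A" and nm: "0 < m" "m < n"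
    and pos: "\<And>s. s > 0 \<Longrightarrow> A s > 0" and fin: "\<And>s. s \<ge> 0 \<Longrightarrow> A s < \<infinity>"
    and \<epsilon>: "\<epsilon> > 0" "(\<integral>\<^sup>+ s\<in>{0..\<epsilon>}. sobolev_integrand n m A s \<partial>lborel) < \<infinity>"
    and \<sigma>t: "0 < \<sigma>" "\<sigma> < 1" "0 < t" "\<sigma> powr (real n / real m) < t"
    and a0: "0 < a\<^sub>0" and growth: "\<And>a. a \<ge> a\<^sub>0 \<Longrightarrow> ennreal t * A a \<le> A (\<sigma> * a)"
  shows "\<exists>K>0. \<forall>r\<ge>a\<^sub>0. sobolev_H n m A r \<le> ennreal (K * r * B r powr (- (real m / real n)))"
proof -
  define q where "q = real m / (real n - real m)"
  define \<delta> where "\<delta> = (real n - real m) / real n"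
  have q: "0 < q" using nm by (simp add: q_def)
  have \<delta>: "0 < \<delta>" "q * \<delta> = real m / real n" "\<delta> + real m / real n = 1"
    using nm by (auto simp: \<delta>_def q_def field_simps)
  have B: "A s = ennreal (B s)" if "s \<ge> 0" for s
    using fin[OF that] by (simp add: B_def less_top)
  have B0: "0 \<le> B s" for s by (simp add: B_def)
  have Bpos: "0 < B s" if "s > 0" for s
    using pos[OF that] fin[of s] that by (simp add: B_def enn2real_positive_iff less_top)
  have B_scale: "B (l * s) \<le> l * B s" if "0 < l" "l \<le> 1" "0 < s" for l s
  proof -
    have "ennreal (B (l * s)) \<le> ennreal (l * B s)"
      using young_scale[OF A, of l s] that B[of s] B[of "l * s"] B0 by (simp add: ennreal_mult)
    then show ?thesis using that Bpos[of s] by (subst (asm) ennreal_le_iff) auto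
  qed
  define \<psi> where "\<psi> s = (s / B s) powr q" for s
  have \<psi>: "sobolev_integrand n m A s = ennreal (\<psi> s)" if "s > 0" for s
    using that Bpos[OF that] unfolding sobolev_integrand_def q_def[symmetric]
    by (simp add: B divide_ennreal ennreal_powr_ennreal \<psi>_def)
  have \<psi>_pos: "0 < \<psi> s" if "s > 0" for s
    using that Bpos[OF that] by (simp add: \<psi>_def)
  have \<psi>_anti: "\<psi> r \<le> \<psi> \<rho>" if "0 < \<rho>" "\<rho> \<le> r" for \<rho> r
  proof -
    have "B (\<rho> / r * r) \<le> \<rho> / r * B r" using that by (intro B_scale) auto
    then have "r / B r \<le> \<rho> / B \<rho>"
      using that Bpos[of r] Bpos[of \<rho>] by (simp add: field_simps)
    then show ?thesis
      unfolding \<psi>_def using that Bpos[of r] q by (intro powr_mono2) auto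
  qed
  define I where "I r = (\<integral>\<^sup>+ s\<in>{0..r}. sobolev_integrand n m A s \<partial>lborel)" for r
  have I_step: "I r \<le> I \<rho> + ennreal ((r - \<rho>) * \<psi> \<rho>)" if "0 < \<rho>" "\<rho> \<le> r" for \<rho> r
  proof -
    have "I r = (\<integral>\<^sup>+ s. sobolev_integrand n m A s * indicator {0..\<rho>} s +
        sobolev_integrand n m A s * indicator {\<rho><..r} s \<partial>lborel)"
      unfolding I_def using that by (intro nn_integral_cong) (auto simp: indicator_def)
    also have "\<dots> = I \<rho> + (\<integral>\<^sup>+ s\<in>{\<rho><..r}. sobolev_integrand n m A s \<partial>lborel)"
      unfolding I_def using that
      by (intro nn_integral_add) (auto intro!: sobolev_integrand_measurable[OF A])
    also have "(\<integral>\<^sup>+ s\<in>{\<rho><..r}. sobolev_integrand n m A s \<partial>lborel) \<le> (\<integral>\<^sup>+ s\<in>{\<rho><..r}. ennreal (\<psi> \<rho>) \<partial>lborel)"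
      using that by (intro nn_integral_mono) (auto simp: indicator_def \<psi> intro!: ennreal_leI \<psi>_anti)
    also have "\<dots> = ennreal ((r - \<rho>) * \<psi> \<rho>)"
      using that \<psi>_pos[of \<rho>] by (simp add: nn_integral_const_interval ennreal_mult'' mult.commute)
    finally show ?thesis by (simp add: add_left_mono)
  qed
  have I_mono: "I \<rho> \<le> I r" if "\<rho> \<le> r" for \<rho> r
    unfolding I_def using that by (intro nn_set_integral_set_mono) auto
  have I_fin: "I r < \<infinity>" for r
  proof -
    have "I r \<le> I (max r \<epsilon>)" by (intro I_mono) simp
    also have "\<dots> \<le> I \<epsilon> + ennreal ((max r \<epsilon> - \<epsilon>) * \<psi> \<epsilon>)" by (intro I_step \<epsilon>) simp
    also have "\<dots> < \<infinity>" using \<epsilon>(2) by (simp add: I_def)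
    finally show ?thesis .
  qed
  define J where "J r = enn2real (I r)" for r
  have J: "I r = ennreal (J r)" for r
    using I_fin[of r] by (simp add: J_def less_top)
  have J0: "0 \<le> J r" for r by (simp add: J_def)
  define \<kappa> where "\<kappa> = (\<sigma> / t) powr q"
  have "\<exists>C>0. \<forall>r\<ge>a\<^sub>0. J r \<le> C * (r * \<psi> r)"
  proof (rule integral_le_const_times_self[OF \<sigma>t(1,2) a0])
    show "0 \<le> \<kappa>" by (simp add: \<kappa>_def)
    show "\<sigma> * \<kappa> < 1"
    proof -
      have "(real n / real m) * q = 1 + q"
        using nm by (simp add: q_def field_simps)
      then have "\<sigma> powr (1 + q) = (\<sigma> powr (real n / real m)) powr q"
        by (simp add: powr_powr)
      also have "\<dots> < t powr q" using \<sigma>t q by (intro powr_less_mono2) auto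
      finally have "\<sigma> * \<sigma> powr q < t powr q" using \<sigma>t by (simp add: powr_add)
      then show ?thesis using \<sigma>t by (simp add: \<kappa>_def powr_divide)
    qed
    show "J \<rho> \<le> J r" if "0 < \<rho>" "\<rho> \<le> r" for \<rho> r
      using I_mono[OF that(2)] J0 by (simp add: J)
    show "J r \<le> J \<rho> + (r - \<rho>) * \<psi> \<rho>" if "0 < \<rho>" "\<rho> \<le> r" for \<rho> r
    proof -
      have nonneg: "0 \<le> (r - \<rho>) * \<psi> \<rho>" using that \<psi>_pos[of \<rho>] by simp
      then have "ennreal (J r) \<le> ennreal (J \<rho> + (r - \<rho>) * \<psi> \<rho>)"
        using I_step[OF that] J0 by (simp add: J)
      then show ?thesis using nonneg J0 by (subst (asm) ennreal_le_iff) auto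
    qed
    show "0 < \<psi> r" if "0 < r" for r using that by (rule \<psi>_pos)
    show "\<psi> r \<le> \<psi> \<rho>" if "0 < \<rho>" "\<rho> \<le> r" for \<rho> r using that by (rule \<psi>_anti)
    show "\<psi> (\<sigma> * r) \<le> \<kappa> * \<psi> r" if r: "a\<^sub>0 \<le> r" for r
    proof -
      have r0: "0 < r" "0 < \<sigma> * r" using r a0 \<sigma>t by auto
      have "ennreal (t * B r) \<le> ennreal (B (\<sigma> * r))"
        using growth[OF r] r0 \<sigma>t B[of r] B[of "\<sigma> * r"] B0 by (simp add: ennreal_mult)
      then have "t * B r \<le> B (\<sigma> * r)"
        using Bpos[of "\<sigma> * r"] r0 by (subst (asm) ennreal_le_iff) auto
      then have "\<sigma> * r / B (\<sigma> * r) \<le> \<sigma> * r / (t * B r)"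
        using r0 \<sigma>t Bpos[of r] Bpos[of "\<sigma> * r"] by (intro divide_left_mono) auto
      also have "\<dots> = (\<sigma> / t) * (r / B r)" by simp
      finally have "\<psi> (\<sigma> * r) \<le> ((\<sigma> / t) * (r / B r)) powr q"
        unfolding \<psi>_def using q r0 \<sigma>t Bpos[of "\<sigma> * r"] by (intro powr_mono2) auto
      also have "\<dots> = \<kappa> * \<psi> r"
        unfolding \<kappa>_def \<psi>_def by (rule powr_mult)
      finally show ?thesis .
    qed
  qed
  then obtain C where C: "0 < C" "\<And>r. a\<^sub>0 \<le> r \<Longrightarrow> J r \<le> C * (r * \<psi> r)" by blast
  have "sobolev_H n m A r \<le> ennreal (C powr \<delta> * r * B r powr (- (real m / real n)))" if r: "a\<^sub>0 \<le> r" for r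
  proof -
    have r0: "0 < r" using r a0 by simp
    have Br: "0 < B r" by (rule Bpos[OF r0])
    have "J r powr \<delta> \<le> (C * (r * \<psi> r)) powr \<delta>"
      using C(2)[OF r] J0 \<delta> by (intro powr_mono2) auto
    also have "\<dots> = C powr \<delta> * (r powr \<delta> * (r / B r) powr (q * \<delta>))"
      using C r0 \<psi>_pos[OF r0] by (simp add: powr_mult \<psi>_def powr_powr)
    also have "r powr \<delta> * (r / B r) powr (q * \<delta>) = r powr (\<delta> + real m / real n) * B r powr (- (real m / real n))"
      unfolding \<delta>(2) using r0 Br by (simp add: powr_divide powr_add powr_minus_divide)
    finally have "J r powr \<delta> \<le> C powr \<delta> * r * B r powr (- (real m / real n))"
      unfolding \<delta>(3) using r0 by (simp add: mult.assoc)
    moreover have "sobolev_H n m A r = ennreal (J r powr \<delta>)"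
      unfolding sobolev_H_def I_def[symmetric] \<delta>_def[symmetric] J by (rule ennreal_powr_ennreal[OF J0])
    ultimately show ?thesis by (simp add: ennreal_leI)
  qed
  moreover have "0 < C powr \<delta>" using C by simp
  ultimately show ?thesis by blast
qed

text \<open>
  To solve \<open>A(s) = y\<close> up to a factor, let \<open>T\<close> be the supremum of the points where \<open>A \<le> y\<close>: a
  point \<open>s\<close> slightly below \<open>T\<close> has \<open>s/\<sigma> > T\<close>, so the growth condition gives
  \<open>t y \<le> A(s) \<le> y\<close>. Then \<open>s' = L s\<close> with \<open>L = 2 c / t\<close> has \<open>A(s') \<ge> L A(s) \<ge> 2 c y\<close>.
\<close>
lemma young_conjugate_gap:
  assumes A: "young_function A" and nm: "0 < m" "m < n"
    and \<epsilon>: "\<epsilon> > 0" "(\<integral>\<^sup>+ s\<in>{0..\<epsilon>}. sobolev_integrand n m A s \<partial>lborel) < \<infinity>"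
    and I: "upper_boyd_index A < ereal (real n / real m)" and c: "1 \<le> c"
  obtains K Y where "0 < K" "0 < Y"
    "\<And>y. y \<ge> Y \<Longrightarrow> \<exists>s>0. \<exists>s'>0. A s \<le> ennreal y \<and> ennreal (c * y) < A s' \<and>
       sobolev_H n m A s' \<le> ennreal (K * s * y powr (- (real m / real n)))"
proof -
  have pos: "A s > 0" if "s > 0" for s
    by (rule young_positive[OF A nm \<epsilon> that])
  have "0 < real n / real m" using nm by simp
  from boyd_index_growth[OF A pos this I]
  obtain \<sigma> t a\<^sub>0 where \<sigma>t: "0 < \<sigma>" "\<sigma> < 1" "0 < t" "t < 1" "\<sigma> powr (real n / real m) < t"
    and a0: "0 < a\<^sub>0" and fin: "\<And>s. s \<ge> 0 \<Longrightarrow> A s < \<infinity>"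
    and growth: "\<And>a. a \<ge> a\<^sub>0 \<Longrightarrow> ennreal t * A a \<le> A (\<sigma> * a)"
    by metis
  define B where "B s = enn2real (A s)" for s
  have B: "A s = ennreal (B s)" if "s \<ge> 0" for s
    using fin[OF that] by (simp add: B_def less_top)
  have B0: "0 \<le> B s" for s by (simp add: B_def)
  have Bpos: "0 < B s" if "s > 0" for s
    using pos[OF that] fin[of s] that by (simp add: B_def enn2real_positive_iff less_top)
  have B_mono: "B r \<le> B s" if "0 \<le> r" "r \<le> s" for r s
    using young_mono[OF A, of r s] that fin[of s] by (auto simp: B_def intro!: enn2real_mono)
  obtain K where K: "0 < K" "\<And>r. a\<^sub>0 \<le> r \<Longrightarrow> sobolev_H n m A r \<le> ennreal (K * r * B r powr (- (real m / real n)))"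
    using sobolev_H_upper_bound[OF A nm pos fin \<epsilon> \<sigma>t(1,2,3,5) a0 growth] unfolding B_def by blast
  define L where "L = 2 * c / t"
  have L: "1 \<le> L" using \<sigma>t c by (simp add: L_def)
  show ?thesis
  proof (rule that[of "K * L" "B (2 * a\<^sub>0)"])
    show "0 < K * L" "0 < B (2 * a\<^sub>0)" using K L a0 by (auto intro: Bpos)
    fix y assume y: "B (2 * a\<^sub>0) \<le> y"
    have y0: "0 < y" using y Bpos[of "2 * a\<^sub>0"] a0 by simp
    let ?S = "{s. 0 \<le> s \<and> B s \<le> y}"
    obtain s\<^sub>1 where s1: "s\<^sub>1 \<ge> 1" "ennreal y < A s\<^sub>1"
      using young_unbounded[OF A pos, of "ennreal y"] by auto
    have bdd: "bdd_above ?S"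
    proof (rule bdd_aboveI[of _ s\<^sub>1])
      fix s assume s: "s \<in> ?S"
      show "s \<le> s\<^sub>1"
      proof (rule ccontr)
        assume "\<not> s \<le> s\<^sub>1"
        then have "B s\<^sub>1 \<le> B s" using s1 by (intro B_mono) auto
        moreover have "y < B s\<^sub>1" using s1 y0 B[of s\<^sub>1] by (simp add: ennreal_less_iff)
        ultimately show False using s by simp
      qed
    qed
    define T where "T = Sup ?S"
    have T: "2 * a\<^sub>0 \<le> T" unfolding T_def using a0 y by (intro cSup_upper bdd) auto
    \<comment> \<open>Any point strictly between \<open>\<sigma> T\<close> and \<open>T\<close> would do.\<close>
  define s where "s = T * (1 + \<sigma>) / 2"
    have s: "a\<^sub>0 \<le> s" "s < T" "T < s / \<sigma>" "s / \<sigma> \<ge> a\<^sub>0"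
    proof -
      have "2 * a\<^sub>0 * 1 \<le> T * (1 + \<sigma>)" using T a0 \<sigma>t by (intro mult_mono) auto
      then show "a\<^sub>0 \<le> s" by (simp add: s_def)
      show "s < T" using T a0 \<sigma>t by (simp add: s_def algebra_simps)
      show *: "T < s / \<sigma>" using T a0 \<sigma>t by (simp add: s_def less_divide_eq algebra_simps)
      show "s / \<sigma> \<ge> a\<^sub>0" using * T a0 by simp
    qed
    have s0: "0 < s" using s a0 by simp
    obtain s\<^sub>2 where "s\<^sub>2 \<in> ?S" "s < s\<^sub>2"
      using s(2) a0 y unfolding T_def by (subst (asm) less_cSup_iff) (auto intro!: bdd exI[of _ "2 * a\<^sub>0"])
    then have Bs_le: "B s \<le> y" using B_mono[of s s\<^sub>2] s0 by auto
    have "s / \<sigma> \<notin> ?S" using s(3) cSup_upper[OF _ bdd, of "s / \<sigma>"] by (auto simp: T_def)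
    then have "y < B (s / \<sigma>)" using s0 \<sigma>t by (auto simp: zero_le_divide_iff)
    moreover have "ennreal (t * B (s / \<sigma>)) \<le> ennreal (B s)"
      using growth[OF s(4)] s0 \<sigma>t B[of s] B[of "s / \<sigma>"] B0 by (simp add: ennreal_mult)
    then have "t * B (s / \<sigma>) \<le> B s"
      using Bpos[OF s0] by (subst (asm) ennreal_le_iff) auto
    ultimately have Bs_ge: "t * y \<le> B s"
      using \<sigma>t by (smt (verit) mult_left_mono)
    have Ls: "a\<^sub>0 \<le> L * s" "0 < L * s" using s s0 L a0 by (auto intro: order_trans mult_right_mono[of 1 L s, simplified])
    have "A (1 / L * (L * s)) \<le> ennreal (1 / L) * A (L * s)"
      using L s0 by (intro young_scale[OF A]) auto
    then have "ennreal (B s) \<le> ennreal (1 / L * B (L * s))"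
      using L s0 Ls B[of s] B[of "L * s"] B0 ennreal_mult[of "1 / L" "B (L * s)"] by simp
    then have "L * B s \<le> B (L * s)"
      using L Bpos[OF Ls(2)] by (subst (asm) ennreal_le_iff) (auto simp: field_simps)
    moreover have "2 * c * y \<le> L * B s"
      using Bs_ge \<sigma>t c mult_left_mono[OF Bs_ge, of L] L by (simp add: L_def)
    ultimately have BL: "2 * (c * y) \<le> B (L * s)" by simp
    have cy: "0 < c * y" "y \<le> c * y" using c y0 by (auto simp: mult_right_mono[of 1 c y, simplified])
    show "\<exists>s>0. \<exists>s'>0. A s \<le> ennreal y \<and> ennreal (c * y) < A s' \<and>
       sobolev_H n m A s' \<le> ennreal (K * L * s * y powr (- (real m / real n)))"
    proof (intro exI conjI)
      show "0 < s" "0 < L * s" by fact+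
      show "A s \<le> ennreal y" using Bs_le s0 B[of s] by (simp add: ennreal_leI)
      show "ennreal (c * y) < A (L * s)" using BL cy Ls B[of "L * s"] by (simp add: ennreal_less_iff)
      have "sobolev_H n m A (L * s) \<le> ennreal (K * (L * s) * B (L * s) powr (- (real m / real n)))"
        by (rule K(2)[OF Ls(1)])
      also have "\<dots> \<le> ennreal (K * L * s * y powr (- (real m / real n)))"
      proof (rule ennreal_leI)
        have "B (L * s) powr (- (real m / real n)) \<le> y powr (- (real m / real n))"
          by (intro powr_mono2') (use BL cy y0 in \<open>linarith | simp\<close>)+
        then show "K * (L * s) * B (L * s) powr (- (real m / real n)) \<le> K * L * s * y powr (- (real m / real n))"
          using K L s0 by (simp add: mult.assoc mult_left_mono)
      qed
      finally show "sobolev_H n m A (L * s) \<le> ennreal (K * L * s * y powr (- (real m / real n)))" .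
    qed
  qed
qed

section \<open>Orlicz norms of bounded functions\<close>

text \<open>On \<open>E\<close> the argument of \<open>A\<close> is at most \<open>s\<close>, and elsewhere it is zero.\<close>
lemma modular_le_1:
  fixes f :: "real^'n \<Rightarrow> real"
  assumes A: "young_function A" and \<Omega>: "\<Omega> \<in> sets lebesgue" and E: "E \<in> sets lebesgue" "E \<subseteq> \<Omega>"
    and \<mu>: "emeasure lebesgue E = ennreal \<mu>" "0 < \<mu>" and D: "0 < D" and s: "0 < s" "A s \<le> ennreal (1 / \<mu>)"
    and f: "AE x in lebesgue. x \<in> \<Omega> \<longrightarrow> \<bar>f x\<bar> \<le> D * indicator E x"
  shows "(\<integral>\<^sup>+ x. A (\<bar>f x\<bar> / (D / s)) \<partial>lebesgue_on \<Omega>) \<le> 1"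
proof -
  have "(\<integral>\<^sup>+ x. A (\<bar>f x\<bar> / (D / s)) \<partial>lebesgue_on \<Omega>) \<le> (\<integral>\<^sup>+ x. A s * indicator E x \<partial>lebesgue_on \<Omega>)"
  proof (rule nn_integral_mono_AE)
    have "AE x in lebesgue_on \<Omega>. \<bar>f x\<bar> \<le> D * indicator E x"
      using f \<Omega> by (subst AE_restrict_space_iff) auto
    then show "AE x in lebesgue_on \<Omega>. A (\<bar>f x\<bar> / (D / s)) \<le> A s * indicator E x"
    proof eventually_elim
      fix x assume fx: "\<bar>f x\<bar> \<le> D * indicator E x"
      show "A (\<bar>f x\<bar> / (D / s)) \<le> A s * indicator E x"
      proof (cases "x \<in> E")
        case True
        then have "\<bar>f x\<bar> / (D / s) \<le> s" using fx D s by (simp add: field_simps)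
        then show ?thesis using True D s by (auto intro!: young_mono[OF A])
      next
        case False
        then show ?thesis using fx by (simp add: young_zero[OF A])
      qed
    qed
  qed
  also have "\<dots> = A s * emeasure (lebesgue_on \<Omega>) E"
    using E \<Omega> by (intro nn_integral_cmult_indicator) (auto simp: sets_restrict_space_iff)
  also have "emeasure (lebesgue_on \<Omega>) E = ennreal \<mu>"
    using E \<Omega> \<mu> by (subst emeasure_restrict_space) auto
  also have "A s * ennreal \<mu> \<le> ennreal (1 / \<mu>) * ennreal \<mu>"
    by (intro mult_right_mono s) simp
  also have "\<dots> = 1" using \<mu> by (simp add: ennreal_mult[symmetric])
  finally show ?thesis .
qed

lemma orlicz_norm_le_of_modular:
  "0 < k \<Longrightarrow> (\<integral>\<^sup>+ x. A (\<bar>f x\<bar> / k) \<partial>lebesgue_on \<Omega>) \<le> 1 \<Longrightarrow> orlicz_norm A \<Omega> f \<le> ennreal k"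
  unfolding orlicz_norm_def by (rule INF_lower) simp

lemma ennreal_powr_mono:
  assumes "x \<le> y" "0 \<le> p"
  shows "ennreal_powr x p \<le> ennreal_powr y p"
proof (cases "y = top")
  case False
  then have "x \<noteq> top" using assms(1) by (auto simp: top_unique)
  moreover have "enn2real x \<le> enn2real y"
    using assms(1) False by (intro enn2real_mono) (auto simp: less_top)
  ultimately show ?thesis
    using False assms(2) by (auto simp: ennreal_powr_def intro!: ennreal_leI powr_mono2)
qed (simp add: ennreal_powr_def)

lemma sobolev_H_mono:
  assumes "m < n" "r \<le> s"
  shows "sobolev_H n m A r \<le> sobolev_H n m A s"
  unfolding sobolev_H_def
  using assms by (intro ennreal_powr_mono nn_set_integral_set_mono) auto

text \<open>
  Since \<open>H\<close> is monotone, every point where \<open>H\<close> reaches \<open>z\<close> lies beyond \<open>s\<close>, so the left inverse of \<open>H\<close> at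
  \<open>z\<close> is at least \<open>s\<close>, possibly infinite.
\<close>
lemma sobolev_conjugate_ge:
  assumes A: "young_function A" and mn: "m < n" and s: "0 < s" and z: "sobolev_H n m A s < ennreal z"
  shows "A s \<le> sobolev_conjugate n m A z"
proof -
  define y where "y = left_inverse (sobolev_H n m A) z"
  have "ennreal s \<le> y"
    unfolding y_def left_inverse_def
  proof (intro INF_greatest)
    fix s' assume "s' \<in> {s'. 0 \<le> s' \<and> ennreal z \<le> sobolev_H n m A s'}"
    then have "sobolev_H n m A s < sobolev_H n m A s'" using z by auto
    then have "s \<le> s'" using sobolev_H_mono[OF mn, of s' s A] by (force simp: not_le[symmetric])
    then show "ennreal s \<le> ennreal s'" by (rule ennreal_leI)
  qed
  then show ?thesis
    using s unfolding sobolev_conjugate_def y_def[symmetric] Let_def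
    by (cases y) (auto intro!: young_mono[OF A])
qed

text \<open>
  For \<open>k < c/h\<close> the value \<open>|f|/k\<close> exceeds \<open>h \<ge> H(s)\<close> on \<open>E\<close>, so the modular of \<open>f/k\<close> is at least
  \<open>A(s) \<mu> > 1\<close>.
\<close>
lemma orlicz_norm_conjugate_ge:
  fixes f :: "real^'n \<Rightarrow> real"
  assumes A: "young_function A" and mn: "m < n" and \<Omega>: "\<Omega> \<in> sets lebesgue" and E: "E \<in> sets lebesgue" "E \<subseteq> \<Omega>"
    and \<mu>: "emeasure lebesgue E = ennreal \<mu>" "0 < \<mu>" and f: "\<And>x. x \<in> E \<Longrightarrow> c \<le> \<bar>f x\<bar>" and c: "0 < c"
    and s: "0 < s" "ennreal (1 / \<mu>) < A s" and h: "0 < h" "sobolev_H n m A s \<le> ennreal h"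
  shows "ennreal (c / h) \<le> orlicz_norm (sobolev_conjugate n m A) \<Omega> f"
  unfolding orlicz_norm_def
proof (rule INF_greatest, rule ccontr)
  fix k assume "k \<in> {k. 0 < k \<and> (\<integral>\<^sup>+ x. sobolev_conjugate n m A (\<bar>f x\<bar> / k) \<partial>lebesgue_on \<Omega>) \<le> 1}"
  then have k: "0 < k" "(\<integral>\<^sup>+ x. sobolev_conjugate n m A (\<bar>f x\<bar> / k) \<partial>lebesgue_on \<Omega>) \<le> 1" by auto
  assume "\<not> ennreal (c / h) \<le> ennreal k"
  then have "k < c / h" using k by (meson ennreal_leI not_le)
  then have hk: "h < c / k" using k h by (simp add: field_simps)
  have "A s * ennreal \<mu> = A s * emeasure (lebesgue_on \<Omega>) E"
    using E \<Omega> \<mu> by (subst emeasure_restrict_space) auto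
  also have "\<dots> = (\<integral>\<^sup>+ x. A s * indicator E x \<partial>lebesgue_on \<Omega>)"
    using E \<Omega> by (intro nn_integral_cmult_indicator[symmetric]) (auto simp: sets_restrict_space_iff)
  also have "\<dots> \<le> (\<integral>\<^sup>+ x. sobolev_conjugate n m A (\<bar>f x\<bar> / k) \<partial>lebesgue_on \<Omega>)"
  proof (intro nn_integral_mono)
    fix x
    show "A s * indicator E x \<le> sobolev_conjugate n m A (\<bar>f x\<bar> / k)"
    proof (cases "x \<in> E")
      case True
      have "c / k \<le> \<bar>f x\<bar> / k" using f[OF True] k by (intro divide_right_mono) auto
      then have "ennreal h < ennreal (\<bar>f x\<bar> / k)" using hk h by (intro ennreal_lessI) auto
      then have "sobolev_H n m A s < ennreal (\<bar>f x\<bar> / k)" using h(2) by (rule le_less_trans[rotated])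
      then show ?thesis using True sobolev_conjugate_ge[OF A mn s(1)] by simp
    qed simp
  qed
  also have "\<dots> \<le> 1" by (rule k)
  finally have le: "A s * ennreal \<mu> \<le> 1" .
  have "1 = ennreal (1 / \<mu>) * ennreal \<mu>" using \<mu> by (simp add: ennreal_mult[symmetric])
  also have "\<dots> < A s * ennreal \<mu>"
    using s(2) \<mu>(2) by (intro ennreal_mult_strict_right_mono) auto
  finally show False using le by simp
qed

section \<open>Rescaled bumps as Sobolev functions\<close>

definition rescaled_bump :: "real^'n \<Rightarrow> real \<Rightarrow> real^'n \<Rightarrow> real" where
  "rescaled_bump x R = (\<lambda>y. bump ((1 / R) *\<^sub>R (y - x)))"

lemma smooth_rescaled_bump: "smooth_fun (rescaled_bump x R)"
  unfolding rescaled_bump_def by (rule smooth_fun_rescale[OF smooth_bump])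

lemma rescaled_bump_ge:
  assumes "0 < R" "y \<in> ball x (R / 2)"
  shows "exp (-4) \<le> \<bar>rescaled_bump x R y\<bar>"
proof -
  have "norm ((1 / R) *\<^sub>R (y - x)) \<le> 1 / 2"
    using assms unfolding norm_scaleR by (simp add: dist_norm norm_minus_commute divide_le_eq)
  then show ?thesis
    unfolding rescaled_bump_def using bump_ge bump_nonneg by fastforce
qed

lemma foldr_partial_deriv_rescaled_bump_le:
  fixes x :: "real^'n"
  assumes R: "0 < R" "R \<le> 1" and len: "length is \<le> m"
    and M: "\<And>is (x::real^'n). length is \<le> m \<Longrightarrow> \<bar>foldr partial_deriv is bump x\<bar> \<le> M"
  shows "\<bar>foldr partial_deriv is (rescaled_bump x R) y\<bar> \<le> M / R ^ m * indicator (ball x R) y"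
proof (cases "y \<in> ball x R")
  case True
  have M0: "0 \<le> M" using M[of "[]" 0] by simp
  have "(1 / R) ^ length is \<le> (1 / R) ^ m"
    using R len by (intro power_increasing) auto
  then have "(1 / R) ^ length is * \<bar>foldr partial_deriv is bump ((1 / R) *\<^sub>R (y - x))\<bar> \<le> (1 / R) ^ m * M"
    using R M0 M[OF len] by (intro mult_mono) auto
  then show ?thesis
    using True R unfolding rescaled_bump_def foldr_partial_deriv_rescale[OF smooth_bump]
    by (simp add: abs_mult power_inverse divide_inverse mult.commute)
next
  case False
  then have "1 \<le> norm ((1 / R) *\<^sub>R (y - x))"
    using R unfolding norm_scaleR by (simp add: dist_norm norm_minus_commute le_divide_eq)
  then have "foldr partial_deriv is bump ((1 / R) *\<^sub>R (y - x)) = 0"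
    by (rule foldr_partial_deriv_bump_outside)
  then show ?thesis
    using False unfolding rescaled_bump_def foldr_partial_deriv_rescale[OF smooth_bump] by simp
qed

text \<open>
  A derivative of order \<open>k \<le> m\<close> is \<open>O(R\<^sup>-\<^sup>k)\<close>, hence \<open>O(R\<^sup>-\<^sup>m)\<close> because \<open>R \<le> 1\<close>. Each of the finitely many
  weak derivatives thus has modular at most 1 at the level \<open>M R\<^sup>-\<^sup>m / s\<close>.
\<close>
lemma rescaled_bump_sobolev:
  fixes \<Omega> :: "(real^'n) set"
  assumes A: "young_function A" and \<Omega>: "open \<Omega>" and R: "0 < R" "R \<le> 1" and M0: "0 < M"
    and M: "\<And>is (x::real^'n). length is \<le> m \<Longrightarrow> \<bar>foldr partial_deriv is bump x\<bar> \<le> M"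
    and \<mu>: "emeasure lebesgue (ball x R \<inter> \<Omega>) = ennreal \<mu>" "0 < \<mu>" and s: "0 < s" "A s \<le> ennreal (1 / \<mu>)"
  shows "rescaled_bump x R \<in> orlicz_sobolev_space m A \<Omega>" (is ?in)
    and "orlicz_sobolev_norm m A \<Omega> (rescaled_bump x R)
      \<le> ennreal (real (card {\<alpha> :: 'n \<Rightarrow> nat. multi_order \<alpha> \<le> m}) * (M / R ^ m / s))" (is ?norm)
proof -
  let ?u = "rescaled_bump x R" and ?k = "M / R ^ m / s"
  note smooth = smooth_rescaled_bump[of x R]
  have \<Omega>': "\<Omega> \<in> sets lebesgue" using \<Omega> by auto
  have k: "0 < ?k" "0 < M / R ^ m" using M0 R s by auto
  have modular: "(\<integral>\<^sup>+ y. A (\<bar>f y\<bar> / ?k) \<partial>lebesgue_on \<Omega>) \<le> 1"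
    if "AE y in lebesgue. y \<in> \<Omega> \<longrightarrow> foldr partial_deriv is ?u y = f y" "length is \<le> m" for f "is"
  proof (rule modular_le_1[OF A \<Omega>' _ _ \<mu> k(2) s])
    show "ball x R \<inter> \<Omega> \<in> sets lebesgue" using \<Omega> by auto
    show "ball x R \<inter> \<Omega> \<subseteq> \<Omega>" by simp
    show "AE y in lebesgue. y \<in> \<Omega> \<longrightarrow> \<bar>f y\<bar> \<le> M / R ^ m * indicator (ball x R \<inter> \<Omega>) y"
      using that(1)
    proof eventually_elim
      fix y assume "y \<in> \<Omega> \<longrightarrow> foldr partial_deriv is ?u y = f y"
      then show "y \<in> \<Omega> \<longrightarrow> \<bar>f y\<bar> \<le> M / R ^ m * indicator (ball x R \<inter> \<Omega>) y"
        using foldr_partial_deriv_rescaled_bump_le[OF R that(2) M, of x y] by (auto simp: indicator_def)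
    qed
  qed
  have in_space: "f \<in> orlicz_space A \<Omega>"
    if "(\<integral>\<^sup>+ y. A (\<bar>f y\<bar> / ?k) \<partial>lebesgue_on \<Omega>) \<le> 1" "f \<in> borel_measurable (lebesgue_on \<Omega>)" for f
    unfolding orlicz_space_def using that k by (auto intro!: exI[of _ ?k] intro: le_less_trans)
  have weak: "(\<integral>\<^sup>+ y. A (\<bar>weak_deriv \<Omega> \<alpha> ?u y\<bar> / ?k) \<partial>lebesgue_on \<Omega>) \<le> 1"
    if "multi_order \<alpha> \<le> m" for \<alpha>
    by (rule modular[OF weak_deriv_smooth_fun[OF smooth \<Omega>]]) (simp add: length_multi_list that)
  have "?u \<in> borel_measurable (lebesgue_on \<Omega>)"
    by (rule measurable_restrict_space1, rule measurable_completion)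
      (use smooth_fun_borel_measurable[OF smooth] in simp)
  moreover have "(\<integral>\<^sup>+ y. A (\<bar>?u y\<bar> / ?k) \<partial>lebesgue_on \<Omega>) \<le> 1"
    by (rule modular[of "[]"]) auto
  ultimately have "?u \<in> orlicz_space A \<Omega>" by (intro in_space)
  then show ?in
    unfolding orlicz_sobolev_space_def
    using has_weak_deriv_smooth_fun[OF smooth \<Omega>] in_space[OF weak weak_deriv_smooth_fun_measurable[OF smooth \<Omega>]]
    by blast
  have "orlicz_sobolev_norm m A \<Omega> ?u \<le> (\<Sum>\<alpha> | multi_order (\<alpha> :: 'n \<Rightarrow> nat) \<le> m. ennreal ?k)"
    unfolding orlicz_sobolev_norm_def
    by (intro sum_mono orlicz_norm_le_of_modular k weak) simp
  also have "\<dots> = ennreal (real (card {\<alpha> :: 'n \<Rightarrow> nat. multi_order \<alpha> \<le> m}) * ?k)"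
    using k ennreal_mult''[of ?k "real (card {\<alpha> :: 'n \<Rightarrow> nat. multi_order \<alpha> \<le> m})"]
    by (simp only: sum_constant ennreal_of_nat_eq_real_of_nat less_imp_le)
  finally show ?norm .
qed

section \<open>The measure density condition\<close>

text \<open>
  A radius where \<open>f(\<rho>) / \<rho>\<^sup>n\<close> is within a factor 2 of its infimum \<open>\<kappa>\<close>: the bound \<open>\<kappa>\<close> at \<open>R/2\<close> then
  compares \<open>f(R/2)\<close> with \<open>f(R)\<close>. The lower bound by \<open>d \<rho>\<^sup>n\<close> makes \<open>\<kappa>\<close> positive.
\<close>
lemma doubling_radius:
  fixes f :: "real \<Rightarrow> real"
  assumes d: "0 < d" "\<And>\<rho>. 0 < \<rho> \<Longrightarrow> \<rho> \<le> 1 \<Longrightarrow> d * \<rho> ^ n \<le> f \<rho>" and r: "0 < r" "r \<le> 1"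
  obtains R where "0 < R" "R \<le> 1" "f R \<le> 2 ^ (n + 1) * f (R / 2)" "f R / R ^ n \<le> 2 * (f r / r ^ n)"
proof -
  let ?Q = "\<lambda>\<rho>. f \<rho> / \<rho> ^ n"
  define \<kappa> where "\<kappa> = Inf (?Q ` {0<..1})"
  have Qd: "d \<le> ?Q \<rho>" if "\<rho> \<in> {0<..1}" for \<rho>
    using d(2)[of \<rho>] that by (simp add: le_divide_eq)
  have bdd: "bdd_below (?Q ` {0<..1})" using Qd by (intro bdd_belowI[of _ d]) auto
  have "d \<le> \<kappa>" unfolding \<kappa>_def using Qd by (intro cInf_greatest) auto
  then have \<kappa>0: "0 < \<kappa>" using d by simp
  have \<kappa>le: "\<kappa> \<le> ?Q \<rho>" if "0 < \<rho>" "\<rho> \<le> 1" for \<rho>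
    unfolding \<kappa>_def using that by (intro cInf_lower bdd) auto
  have "Inf (?Q ` {0<..1}) < 2 * \<kappa>" using \<kappa>0 by (simp add: \<kappa>_def)
  then obtain R where R: "0 < R" "R \<le> 1" "?Q R < 2 * \<kappa>"
    by (subst (asm) cInf_less_iff) (auto intro: bdd)
  show ?thesis
  proof (rule that[OF R(1,2)])
    have "f R \<le> 2 * \<kappa> * R ^ n" using R by (simp add: divide_less_eq)
    also have "\<dots> = 2 ^ (n + 1) * (\<kappa> * (R / 2) ^ n)" by (simp add: power_divide)
    also have "\<dots> \<le> 2 ^ (n + 1) * f (R / 2)"
      using \<kappa>le[of "R / 2"] R by (intro mult_left_mono) (auto simp: le_divide_eq)
    finally show "f R \<le> 2 ^ (n + 1) * f (R / 2)" .
    show "f R / R ^ n \<le> 2 * (f r / r ^ n)" using R \<kappa>le[OF r] by simp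
  qed
qed

text \<open>
  If the ball of radius \<open>\<rho>\<^sub>0 \<le> 1\<close> lies in \<open>\<Omega>\<close>, then so does the ball of radius \<open>\<rho>\<^sub>0 \<rho>\<close>, and the latter is
  contained in the ball of radius \<open>\<rho>\<close>. The constant depends on \<open>x\<close>.
\<close>
lemma measure_ball_Int_open_ge:
  fixes \<Omega> :: "(real^'n) set"
  assumes \<Omega>: "open \<Omega>" and x: "x \<in> \<Omega>"
  shows "\<exists>d>0. \<forall>\<rho>. 0 < \<rho> \<and> \<rho> \<le> 1 \<longrightarrow> d * \<rho> ^ CARD('n) \<le> measure lebesgue (ball x \<rho> \<inter> \<Omega>)"
proof -
  obtain \<rho>\<^sub>1 where "\<rho>\<^sub>1 > 0" "ball x \<rho>\<^sub>1 \<subseteq> \<Omega>" using \<Omega> x openE by blast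
  define \<rho>\<^sub>0 where "\<rho>\<^sub>0 = min 1 \<rho>\<^sub>1"
  have \<rho>0: "0 < \<rho>\<^sub>0" "\<rho>\<^sub>0 \<le> 1" "ball x \<rho>\<^sub>0 \<subseteq> \<Omega>"
    using \<open>\<rho>\<^sub>1 > 0\<close> \<open>ball x \<rho>\<^sub>1 \<subseteq> \<Omega>\<close> by (auto simp: \<rho>\<^sub>0_def)
  let ?v = "unit_ball_vol (real CARD('n))"
  have v: "0 < ?v" by simp
  show ?thesis
  proof (intro exI[of _ "?v * \<rho>\<^sub>0 ^ CARD('n)"] conjI allI impI)
    show "0 < ?v * \<rho>\<^sub>0 ^ CARD('n)" using v \<rho>0 by simp
    fix \<rho> :: real assume \<rho>: "0 < \<rho> \<and> \<rho> \<le> 1"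
    have "?v * \<rho>\<^sub>0 ^ CARD('n) * \<rho> ^ CARD('n) = ?v * (\<rho>\<^sub>0 * \<rho>) ^ CARD('n)"
      by (simp add: power_mult_distrib)
    also have "\<dots> = measure lebesgue (ball x (\<rho>\<^sub>0 * \<rho>))"
      using \<rho> \<rho>0 by (simp add: content_ball)
    also have "\<dots> \<le> measure lebesgue (ball x \<rho> \<inter> \<Omega>)"
    proof (rule measure_mono_fmeasurable)
      have "\<rho>\<^sub>0 * \<rho> \<le> \<rho>\<^sub>0" "\<rho>\<^sub>0 * \<rho> \<le> \<rho>" using \<rho> \<rho>0 by (auto simp: mult_left_le mult_left_le_one_le)
      then show "ball x (\<rho>\<^sub>0 * \<rho>) \<subseteq> ball x \<rho> \<inter> \<Omega>" using \<rho>0(3) by auto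
      show "ball x (\<rho>\<^sub>0 * \<rho>) \<in> sets lebesgue" by auto
      show "ball x \<rho> \<inter> \<Omega> \<in> lmeasurable" using \<Omega> by (intro lmeasurable_open bounded_Int open_Int) auto
    qed
    finally show "?v * \<rho>\<^sub>0 ^ CARD('n) * \<rho> ^ CARD('n) \<le> measure lebesgue (ball x \<rho> \<inter> \<Omega>)" .
  qed
qed

text \<open>
  Comparing both sides of the embedding for the bump at scale \<open>R\<close>, the factor \<open>s\<close> cancels and leaves
  \<open>R\<^sup>m \<le> const \<sqdot> f(R) powr (m/n)\<close>.
\<close>
lemma measure_density_at_doubling_radius:
  fixes \<Omega> :: "(real^'n) set" and x :: "real^'n"
  defines "f \<equiv> \<lambda>\<rho>. measure lebesgue (ball x \<rho> \<inter> \<Omega>)"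
  assumes A: "young_function A" and mn: "0 < m" "m < CARD('n)" and \<Omega>: "open \<Omega>"
    and C: "0 < C" "\<And>u. u \<in> orlicz_sobolev_space m A \<Omega> \<Longrightarrow>
      orlicz_norm (sobolev_conjugate CARD('n) m A) \<Omega> u \<le> ennreal C * orlicz_sobolev_norm m A \<Omega> u"
    and M0: "0 < M" and M: "\<And>is (x::real^'n). length is \<le> m \<Longrightarrow> \<bar>foldr partial_deriv is bump x\<bar> \<le> M"
    and R: "0 < R" "R \<le> 1" and f_pos: "0 < f R" "0 < f (R / 2)" and doubling: "f R \<le> c * f (R / 2)"
    and K: "0 < K" and s: "0 < s" "A s \<le> ennreal (1 / f R)" and s': "0 < s'" "ennreal (c * (1 / f R)) < A s'"
    and H: "sobolev_H CARD('n) m A s' \<le> ennreal (K * s * (1 / f R) powr (- (real m / real CARD('n))))"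
  shows "R ^ CARD('n) \<le>
    (C * real (card {\<alpha> :: 'n \<Rightarrow> nat. multi_order \<alpha> \<le> m}) * M * K / exp (-4)) powr (real CARD('n) / real m) * f R"
proof -
  let ?n = "real CARD('n)" and ?N = "real (card {\<alpha> :: 'n \<Rightarrow> nat. multi_order \<alpha> \<le> m})"
  let ?u = "rescaled_bump x R" and ?e = "exp (-4) :: real"
  define h where "h = K * s * (1 / f R) powr (- (real m / ?n))"
  have h0: "0 < h" using K s f_pos by (simp add: h_def)
  have h: "h = K * s * f R powr (real m / ?n)"
    using f_pos by (simp add: h_def powr_minus powr_divide)
  have lm: "ball x \<rho> \<inter> \<Omega> \<in> lmeasurable" for \<rho>
    using \<Omega> by (intro lmeasurable_open bounded_Int open_Int) auto
  have em: "emeasure lebesgue (ball x \<rho> \<inter> \<Omega>) = ennreal (f \<rho>)" for \<rho>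
    unfolding f_def by (rule emeasure_eq_measure2[OF lm])
  have "1 / f (R / 2) \<le> c * (1 / f R)"
    using doubling f_pos by (simp add: field_simps)
  then have s'2: "ennreal (1 / f (R / 2)) < A s'"
    using s'(2) by (meson ennreal_leI le_less_trans)
  note u = rescaled_bump_sobolev[OF A \<Omega> R M0 M em f_pos(1) s]
  have "ennreal (?e / h) \<le> orlicz_norm (sobolev_conjugate CARD('n) m A) \<Omega> ?u"
  proof (rule orlicz_norm_conjugate_ge[OF A mn(2) _ _ _ em f_pos(2) _ _ s'(1) s'2 h0])
    show "\<Omega> \<in> sets lebesgue" "ball x (R / 2) \<inter> \<Omega> \<in> sets lebesgue" using \<Omega> by auto
    show "sobolev_H CARD('n) m A s' \<le> ennreal h" using H by (simp add: h_def)
    show "?e \<le> \<bar>?u y\<bar>" if "y \<in> ball x (R / 2) \<inter> \<Omega>" for y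
      using that by (intro rescaled_bump_ge[OF R(1)]) auto
  qed auto
  also have "\<dots> \<le> ennreal C * orlicz_sobolev_norm m A \<Omega> ?u" by (rule C(2)[OF u(1)])
  also have "\<dots> \<le> ennreal C * ennreal (?N * (M / R ^ m / s))" by (rule mult_left_mono[OF u(2) zero_le])
  also have "\<dots> = ennreal (C * (?N * (M / R ^ m / s)))" using C M0 R s by (intro ennreal_mult[symmetric]) auto
  finally have "?e / h \<le> C * (?N * (M / R ^ m / s))"
    using C M0 R s by (subst (asm) ennreal_le_iff) auto
  then have "?e * (R ^ m * s) \<le> C * ?N * M * h"
    using R s h0 by (simp add: field_simps)
  then have "?e * R ^ m * s \<le> C * ?N * M * K * f R powr (real m / ?n) * s"
    by (simp add: h mult_ac)
  then have "?e * R ^ m \<le> C * ?N * M * K * f R powr (real m / ?n)"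
    using s by simp
  then have le: "R ^ m \<le> C * ?N * M * K / ?e * f R powr (real m / ?n)" (is "_ \<le> ?Q * _")
    by (simp add: field_simps)
  have Q0: "0 \<le> ?Q" using C M0 K by simp
  have "R ^ CARD('n) = R powr ?n" by (rule powr_realpow[OF R(1), symmetric])
  also have "\<dots> = (R powr real m) powr (?n / real m)"
    by (subst powr_powr) (use mn in simp)
  also have "R powr real m = R ^ m" by (rule powr_realpow[OF R(1)])
  also have "(R ^ m) powr (?n / real m) \<le> (?Q * f R powr (real m / ?n)) powr (?n / real m)"
    using le R mn by (intro powr_mono2) auto
  also have "\<dots> = ?Q powr (?n / real m) * f R"
    unfolding powr_mult[of ?Q] powr_powr using f_pos mn by simp
  finally show ?thesis .
qed

theorem theorem3p4:
  fixes A :: "real \<Rightarrow> ennreal" and \<Omega> :: "(real^'n) set" and m :: nat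
  assumes "CARD('n) \<ge> 2" and "1 \<le> m" and "m < CARD('n)"
    and "young_function A"
    and "\<exists>\<epsilon>>0. (\<integral>\<^sup>+ s\<in>{0..\<epsilon>}. sobolev_integrand CARD('n) m A s \<partial>lborel) < \<infinity>"
    and "open \<Omega>"
    and "\<exists>C>0. \<forall>u\<in>orlicz_sobolev_space m A \<Omega>.
           orlicz_norm (sobolev_conjugate CARD('n) m A) \<Omega> u
             \<le> ennreal C * orlicz_sobolev_norm m A \<Omega> u"
    and "upper_boyd_index A < ereal (real CARD('n) / real m)"
  shows "\<exists>c>0. \<forall>x\<in>\<Omega>. \<forall>r. 0 < r \<and> r \<le> 1 \<longrightarrow>
           measure lebesgue (ball x r \<inter> \<Omega>) \<ge> c * r ^ CARD('n)"
proof -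
  note A = assms(4) and \<Omega> = assms(6) and I = assms(8)
  have m: "0 < m" using assms(2) by simp
  note mn = m assms(3)
  obtain \<epsilon> where \<epsilon>: "\<epsilon> > 0" "(\<integral>\<^sup>+ s\<in>{0..\<epsilon>}. sobolev_integrand CARD('n) m A s \<partial>lborel) < \<infinity>"
    using assms(5) by blast
  obtain C where C: "0 < C" "\<And>u. u \<in> orlicz_sobolev_space m A \<Omega> \<Longrightarrow>
      orlicz_norm (sobolev_conjugate CARD('n) m A) \<Omega> u \<le> ennreal C * orlicz_sobolev_norm m A \<Omega> u"
    using assms(7) by blast
  obtain M where M: "0 < M" "\<And>is (x::real^'n). length is \<le> m \<Longrightarrow> \<bar>foldr partial_deriv is bump x\<bar> \<le> M"
    using foldr_partial_deriv_bump_bounded by blast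
  \<comment> \<open>The doubling constant of an almost minimal radius.\<close>
  define c where "c = (2::real) ^ (CARD('n) + 1)"
  have "1 \<le> c" unfolding c_def by (rule one_le_power) simp
  then obtain K Y where K: "0 < K" and Y: "0 < Y"
    and gap: "\<And>y. y \<ge> Y \<Longrightarrow> \<exists>s>0. \<exists>s'>0. A s \<le> ennreal y \<and> ennreal (c * y) < A s' \<and>
       sobolev_H CARD('n) m A s' \<le> ennreal (K * s * y powr (- (real m / real CARD('n))))"
    using young_conjugate_gap[OF A mn \<epsilon> I] by metis
  define Q where "Q = (C * real (card {\<alpha> :: 'n \<Rightarrow> nat. multi_order \<alpha> \<le> m}) * M * K / exp (-4))
    powr (real CARD('n) / real m)"
  \<comment> \<open>The first bound serves radii where \<open>f R\<close> is not small, the second the remaining ones; both lose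
    the factor 2 of the almost minimal radius.\<close>
  define b where "b = min (1 / (2 * Y)) (1 / (2 * (Q + 1)))"
  have Q0: "0 \<le> Q" by (simp add: Q_def)
  have b0: "0 < b" using Y Q0 by (simp add: b_def)
  have "b * r ^ CARD('n) \<le> measure lebesgue (ball x r \<inter> \<Omega>)" if x: "x \<in> \<Omega>" and r: "0 < r" "r \<le> 1" for x r
  proof -
    define f where "f \<rho> = measure lebesgue (ball x \<rho> \<inter> \<Omega>)" for \<rho>
    obtain d where d: "0 < d" "\<And>\<rho>. 0 < \<rho> \<Longrightarrow> \<rho> \<le> 1 \<Longrightarrow> d * \<rho> ^ CARD('n) \<le> f \<rho>"
      using measure_ball_Int_open_ge[OF \<Omega> x] unfolding f_def by blast
    have f_pos: "0 < f \<rho>" if "0 < \<rho>" "\<rho> \<le> 1" for \<rho>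
      using d(2)[OF that] mult_pos_pos[OF d(1), of "\<rho> ^ CARD('n)"] that by simp
    obtain R where R: "0 < R" "R \<le> 1" and doubling: "f R \<le> c * f (R / 2)"
      and fR: "f R / R ^ CARD('n) \<le> 2 * (f r / r ^ CARD('n))"
      using doubling_radius[OF d r] unfolding c_def by metis
    have "2 * b \<le> f R / R ^ CARD('n)"
    proof (cases "1 / Y \<le> f R")
      case True
      have "2 * b \<le> 1 / Y" by (simp add: b_def min_def)
      also have "\<dots> \<le> f R" by (rule True)
      also have "\<dots> \<le> f R / R ^ CARD('n)"
        using R f_pos[OF R] by (simp add: le_divide_eq mult_left_le power_le_one)
      finally show ?thesis .
    next
      case False
      then have "Y \<le> 1 / f R" using Y f_pos[OF R] by (simp add: field_simps)
      from gap[OF this] obtain s s' where s: "0 < s" "A s \<le> ennreal (1 / f R)"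
        and s': "0 < s'" "ennreal (c * (1 / f R)) < A s'"
        and H: "sobolev_H CARD('n) m A s' \<le> ennreal (K * s * (1 / f R) powr (- (real m / real CARD('n))))"
        by blast
      have "R ^ CARD('n) \<le> Q * f R"
        unfolding Q_def f_def
        by (rule measure_density_at_doubling_radius[OF A mn \<Omega> C M R _ _ _ K s(1) _ s'(1)])
          (use f_pos[OF R] f_pos[of "R / 2"] R doubling s s' H in \<open>auto simp: f_def\<close>)
      also have "\<dots> \<le> (Q + 1) * f R" using f_pos[OF R] by (intro mult_right_mono) auto
      finally have "1 / (Q + 1) \<le> f R / R ^ CARD('n)"
        using Q0 R by (simp add: field_simps)
      moreover have "b \<le> 1 / (2 * (Q + 1))" unfolding b_def by (rule min.cobounded2)
      then have "2 * b \<le> 1 / (Q + 1)" using Q0 by (simp add: field_simps)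
      ultimately show ?thesis by simp
    qed
    with fR have "b \<le> f r / r ^ CARD('n)" by simp
    then show ?thesis using r by (simp add: le_divide_eq f_def)
  qed
  with b0 show ?thesis by blast
qed

end
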